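(* For each equipped finite group $(G,O)$ whose elements of $O$ generate $G$, there is a constant $T=T_{(G,O)}$ such that if $s_1\in S(G,O)^G$ satisfies $\tau_i(s_1)\ge T$ for all $i=1,\dots,m$, then there are $a_{(G,O)}$ elements $s_1,\dots,s_{a_{(G,O)}}\in S(G,O)^G$ such that (i) $s_i\ne s_j$ for $1\le i<j\le a_{(G,O)}$; (ii) $\tau(s_i)=\tau(s_1)$ for all $i$; (iii) $\alpha_G(s_i)=\alpha_G(s_1)$ for all $i$; (iv) if $s\in S(G,O)^G$ satisfies $\tau(s)=\tau(s_1)$ and $\alpha_G(s)=\alpha_G(s_1)$, then $s=s_i$ for some $i$.
   Context: An equipped group is a pair $(G,O)$, $G$ a group, $O\subset G$ a union of finitely many conjugacy classes $C_1,\dots,C_m$ of $G$ (fixed numbering), $1\notin O$. The factorization semigroup $S(G,O)$ is generated by symbols $x_g$, $g\in O$, subject to $x_{g_1}x_{g_2}=x_{g_2}x_{g_2^{-1}g_1g_2}=x_{g_1g_2g_1^{-1}}x_{g_1}$ ($g_1,g_2\in O$); $\alpha_G:S(G,O)\to G$, $x_g\mapsto g$. For $s=x_{g_1}\cdots x_{g_n}$, $G_s$ is the subgroup generated by $g_1,\dots,g_n$ (well defined), $S(G,O)^G=\{s:G_s=G\}$. The type $\tau(s)=(\tau_1(s),\dots,\tau_m(s))$ with $\tau_i(s)$ the number of factors $x_g$ of $s$ with $g\in C_i$. Ambiguity index: let $\widehat G$ be the group with generators $y_g$ ($g\in O$) and relations $y_h^{-1}y_gy_h=y_{h^{-1}gh}$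 for all $g,h\in O$, and $\beta:\widehat G\to G$, $y_g\mapsto g$, with kernel $H$ (central in $\widehat G$); $a_{(G,O)}=|H\cap[\widehat G,\widehat G]|$. *)

theory Defs
  imports "HOL-Algebra.Algebra"
begin

definition conj_class :: "('a, 'b) monoid_scheme \<Rightarrow> 'a \<Rightarrow> 'a set" where
  "conj_class G x = {inv\<^bsub>G\<^esub> g \<otimes>\<^bsub>G\<^esub> x \<otimes>\<^bsub>G\<^esub> g | g. g \<in> carrier G}"

text \<open>An equipped group: Os is the union of the (distinct) conjugacy classes in the
  list Cs (this list fixes the numbering C_1,...,C_m), and 1 is not in Os.\<close>
definition equipped :: "('a, 'b) monoid_scheme \<Rightarrow> 'a set list \<Rightarrow> bool" where
  "equipped G Cs \<longleftrightarrow> group G \<and> distinct Cs \<and>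
     (\<forall>C \<in> set Cs. \<exists>x \<in> carrier G. C = conj_class G x) \<and> \<one>\<^bsub>G\<^esub> \<notin> \<Union>(set Cs)"

inductive hurwitz_step :: "('a, 'b) monoid_scheme \<Rightarrow> 'a set \<Rightarrow> 'a list \<Rightarrow> 'a list \<Rightarrow> bool" where
  move1: "g1 \<in> Os \<Longrightarrow> g2 \<in> Os \<Longrightarrow>
    hurwitz_step G Os (xs @ [g1, g2] @ ys) (xs @ [g2, monoid.mult G (monoid.mult G (m_inv G g2) g1) g2] @ ys)"
| move2: "g1 \<in> Os \<Longrightarrow> g2 \<in> Os \<Longrightarrow>
    hurwitz_step G Os (xs @ [g1, g2] @ ys) (xs @ [monoid.mult G (monoid.mult G g1 g2) (m_inv G g1), g1] @ ys)"

definition fact_equiv :: "('a, 'b) monoid_scheme \<Rightarrow> 'a set \<Rightarrow> 'a list \<Rightarrow> 'a list \<Rightarrow> bool" where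
  "fact_equiv G Os = equivclp (hurwitz_step G Os)"

definition fact_class :: "('a, 'b) monoid_scheme \<Rightarrow> 'a set \<Rightarrow> 'a list \<Rightarrow> 'a list set" where
  "fact_class G Os w = {v. fact_equiv G Os w v}"

definition fact_semigroup :: "('a, 'b) monoid_scheme \<Rightarrow> 'a set \<Rightarrow> 'a list set set" where
  "fact_semigroup G Os = fact_class G Os ` {w. w \<in> lists Os \<and> w \<noteq> []}"

definition rep :: "'a list set \<Rightarrow> 'a list" where
  "rep s = (SOME w. w \<in> s)"

definition word_prod :: "('a, 'b) monoid_scheme \<Rightarrow> 'a list \<Rightarrow> 'a" where
  "word_prod G w = foldr (\<lambda>g h. g \<otimes>\<^bsub>G\<^esub> h) w \<one>\<^bsub>G\<^esub>"

definition alpha :: "('a, 'b) monoid_scheme \<Rightarrow> 'a list set \<Rightarrow> 'a" where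
  "alpha G s = word_prod G (rep s)"

definition sub_gen :: "('a, 'b) monoid_scheme \<Rightarrow> 'a list set \<Rightarrow> 'a set" where
  "sub_gen G s = generate G (set (rep s))"

definition fact_semigroup_gen :: "('a, 'b) monoid_scheme \<Rightarrow> 'a set \<Rightarrow> 'a list set set" where
  "fact_semigroup_gen G Os = {s \<in> fact_semigroup G Os. sub_gen G s = carrier G}"

text \<open>tau_i (0-indexed, i < length Cs) and the type tau\<close>
definition tau_i :: "'a set list \<Rightarrow> nat \<Rightarrow> 'a list set \<Rightarrow> nat" where
  "tau_i Cs i s = length (filter (\<lambda>g. g \<in> Cs ! i) (rep s))"

definition tau :: "'a set list \<Rightarrow> 'a list set \<Rightarrow> nat list" where
  "tau Cs s = map (\<lambda>i. tau_i Cs i s) [0..<length Cs]"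

text \<open>Words for hat G: letter (g,True) stands for y_g, (g,False) for y_g^{-1}.\<close>
inductive hat_step :: "('a, 'b) monoid_scheme \<Rightarrow> 'a set \<Rightarrow> ('a \<times> bool) list \<Rightarrow> ('a \<times> bool) list \<Rightarrow> bool" where
  cancel: "g \<in> Os \<Longrightarrow> hat_step G Os (xs @ [(g, b), (g, \<not> b)] @ ys) (xs @ ys)"
| relator: "g \<in> Os \<Longrightarrow> h \<in> Os \<Longrightarrow>
    hat_step G Os (xs @ [(h, False), (g, True), (h, True)] @ ys)
                 (xs @ [(monoid.mult G (monoid.mult G (m_inv G h) g) h, True)] @ ys)"

definition hat_equiv :: "('a, 'b) monoid_scheme \<Rightarrow> 'a set \<Rightarrow> ('a \<times> bool) list \<Rightarrow> ('a \<times> bool) list \<Rightarrow> bool" where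
  "hat_equiv G Os = equivclp (hat_step G Os)"

definition hat_class :: "('a, 'b) monoid_scheme \<Rightarrow> 'a set \<Rightarrow> ('a \<times> bool) list \<Rightarrow> ('a \<times> bool) list set" where
  "hat_class G Os w = {v. v \<in> lists (Os \<times> UNIV) \<and> hat_equiv G Os w v}"

definition hat_group :: "('a, 'b) monoid_scheme \<Rightarrow> 'a set \<Rightarrow> ('a \<times> bool) list set monoid" where
  "hat_group G Os = \<lparr> carrier = hat_class G Os ` lists (Os \<times> UNIV),
     monoid.mult = (\<lambda>A B. hat_class G Os ((SOME a. a \<in> A) @ (SOME b. b \<in> B))),
     one = hat_class G Os [] \<rparr>"

definition hat_letter :: "('a, 'b) monoid_scheme \<Rightarrow> 'a \<times> bool \<Rightarrow> 'a" where
  "hat_letter G x = (if snd x then fst x else inv\<^bsub>G\<^esub> (fst x))"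

definition hat_beta :: "('a, 'b) monoid_scheme \<Rightarrow> ('a \<times> bool) list set \<Rightarrow> 'a" where
  "hat_beta G A = word_prod G (map (hat_letter G) (SOME a. a \<in> A))"

definition ambiguity_index :: "('a, 'b) monoid_scheme \<Rightarrow> 'a set \<Rightarrow> nat" where
  "ambiguity_index G Os =
     card (kernel (hat_group G Os) G (hat_beta G) \<inter>
           derived (hat_group G Os) (carrier (hat_group G Os)))"

end

theory Submission
  imports Defs
begin

text \<open>
  Put \<open>n = |G|\<close>. Since \<open>g^n = 1\<close>, the power \<open>x_g^n\<close> is central in the factorization semigroup, and in
  front of a word whose letters generate \<open>G\<close> it may be replaced by \<open>x_h^n\<close> for every conjugate \<open>h\<close>
  of \<open>g\<close>. By the pigeonhole principle a generating word with many letters of the class of \<open>g\<close> is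
  therefore \<open>x_g^n\<close> times a generating word. As \<open>y_g^-1 = y_g^(n-1) (y_g^n)^-1\<close>, the hat group arises
  from the semigroup by inverting these central powers, so two positive words agree in the hat group
  iff they agree after multiplication by a product of such powers. By the splitting property this
  product can be chosen uniformly, and then it can be split off from every word of large type.
  Hence on words of large type the map to the hat group is injective, and its image consists of
  all elements of that type. The elements with given type and product thus form a coset of
  the subgroup of \<open>H\<close> of elements of type zero, which is the intersection of \<open>H\<close> with the derived subgroup,
  because the abelianization is free on the classes.
\<close>

section \<open>Equivalence closures and letter counts of lists\<close>

lemma equivclp_invariant:
  assumes "equivclp r x y" and "\<And>x y. r x y \<Longrightarrow> f x = f y"
  shows "f x = f y"
  using assms(1) by (induction) (auto dest: assms(2))

lemma equivclp_map:
  assumes "equivclp r x y" and "\<And>x y. r x y \<Longrightarrow> equivclp q (f x) (f y)"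
  shows "equivclp q (f x) (f y)"
  using assms(1)
proof induction
  case (step y z)
  from step.hyps(2) have "equivclp q (f y) (f z)"
    using assms(2) equivclp_sym by metis
  with step.IH show ?case by (rule equivclp_trans)
qed simp

lemma hurwitz_step_context:
  "hurwitz_step G Os u v \<Longrightarrow> hurwitz_step G Os (a @ u @ b) (a @ v @ b)"
proof (induction rule: hurwitz_step.induct)
  case (move1 g1 Os g2 G xs ys)
  from hurwitz_step.move1[OF this, where xs = "a @ xs" and ys = "ys @ b"] show ?case by simp
next
  case (move2 g1 Os g2 G xs ys)
  from hurwitz_step.move2[OF this, where xs = "a @ xs" and ys = "ys @ b"] show ?case by simp
qed

lemma hat_step_context: "hat_step G Os u v \<Longrightarrow> hat_step G Os (a @ u @ b) (a @ v @ b)"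
proof (induction rule: hat_step.induct)
  case (cancel g Os G xs c ys)
  from hat_step.cancel[OF this, where xs = "a @ xs" and ys = "ys @ b"] show ?case by simp
next
  case (relator g Os h G xs ys)
  from hat_step.relator[OF this, where xs = "a @ xs" and ys = "ys @ b"] show ?case by simp
qed

lemma length_filter_mem_eq_sum_count:
  "finite A \<Longrightarrow> length (filter (\<lambda>x. x \<in> A) w) = (\<Sum>a\<in>A. count_list w a)"
proof -
  assume A: "finite A"
  have "length (filter (\<lambda>x. x \<in> A) w) = (\<Sum>a\<in>A. count_list (filter (\<lambda>x. x \<in> A) w) a)"
    by (rule sum_count_set[symmetric]) (use A in auto)
  also have "\<dots> = (\<Sum>a\<in>A. count_list w a)"
    by (rule sum.cong) (auto simp: count_list_eq_length_filter intro!: arg_cong[of _ _ length] filter_cong)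
  finally show ?thesis .
qed

lemma pigeonhole_count_list:
  assumes "finite A" and "card A * k < length (filter (\<lambda>x. x \<in> A) w)"
  shows "\<exists>a\<in>A. k < count_list w a"
proof (rule ccontr)
  assume "\<not> ?thesis"
  then have "(\<Sum>a\<in>A. count_list w a) \<le> (\<Sum>a\<in>A. k)"
    by (intro sum_mono) (auto simp: not_less)
  with assms show False by (simp add: length_filter_mem_eq_sum_count)
qed

lemma (in group) mult_inv_cancel [simp]:
  "\<lbrakk>g \<in> carrier G; a \<in> carrier G\<rbrakk> \<Longrightarrow> g \<otimes> (inv g \<otimes> a) = a"
  "\<lbrakk>g \<in> carrier G; a \<in> carrier G\<rbrakk> \<Longrightarrow> inv g \<otimes> (g \<otimes> a) = a"
  by (simp_all flip: m_assoc)

section \<open>Hurwitz moves\<close>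

locale conj_invariant_subset = group G for G (structure) +
  fixes Os :: "'a set"
  assumes Os_subset: "Os \<subseteq> carrier G"
    and conj_closed: "\<lbrakk>a \<in> Os; g \<in> carrier G\<rbrakk> \<Longrightarrow> inv g \<otimes> a \<otimes> g \<in> Os"
begin

abbreviation hurwitz_equiv (infix "\<asymp>" 50) where "u \<asymp> v \<equiv> fact_equiv G Os u v"
abbreviation hat_word_equiv (infix "\<asymp>\<^sub>y" 50) where "u \<asymp>\<^sub>y v \<equiv> hat_equiv G Os u v"

lemma mem_carrier [simp]: "a \<in> Os \<Longrightarrow> a \<in> carrier G"
  using Os_subset by auto

lemma conj_closed' [simp]: "\<lbrakk>a \<in> Os; g \<in> carrier G\<rbrakk> \<Longrightarrow> g \<otimes> a \<otimes> inv g \<in> Os"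
  using conj_closed[of a "inv g"] by simp

declare conj_closed [simp]

lemma equiv_refl [simp]: "u \<asymp> u"
  by (simp add: fact_equiv_def)

lemma equiv_sym: "u \<asymp> v \<Longrightarrow> v \<asymp> u"
  unfolding fact_equiv_def by (rule equivclp_sym)

lemma equiv_trans [trans]: "u \<asymp> v \<Longrightarrow> v \<asymp> w \<Longrightarrow> u \<asymp> w"
  unfolding fact_equiv_def by (rule equivclp_trans)

lemma equiv_context: "u \<asymp> v \<Longrightarrow> a @ u @ b \<asymp> a @ v @ b"
  unfolding fact_equiv_def
  by (erule equivclp_map[where f = "\<lambda>x. a @ x @ b"]) (blast intro: hurwitz_step_context)

lemma equiv_append:
  assumes "u \<asymp> u'" "v \<asymp> v'" shows "u @ v \<asymp> u' @ v'"
proof -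
  have "u @ v \<asymp> u' @ v" using equiv_context[OF assms(1), of "[]" v] by simp
  also have "\<dots> \<asymp> u' @ v'" using equiv_context[OF assms(2), of u' "[]"] by simp
  finally show ?thesis .
qed

lemma equiv_Cons: "u \<asymp> v \<Longrightarrow> g # u \<asymp> g # v"
  using equiv_append[of "[g]" "[g]"] by simp

lemma equiv_swap_right:
  "\<lbrakk>g \<in> Os; h \<in> Os\<rbrakk> \<Longrightarrow> g # h # w \<asymp> h # (inv h \<otimes> g \<otimes> h) # w"
  unfolding fact_equiv_def using hurwitz_step.move1[of g Os h G "[]" w] by auto

lemma equiv_swap_left:
  "\<lbrakk>g \<in> Os; h \<in> Os\<rbrakk> \<Longrightarrow> g # h # w \<asymp> (g \<otimes> h \<otimes> inv g) # g # w"
  unfolding fact_equiv_def using hurwitz_step.move2[of g Os h G "[]" w] by auto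

lemma word_prod_Nil [simp]: "word_prod G [] = \<one>"
  and word_prod_Cons [simp]: "word_prod G (a # w) = a \<otimes> word_prod G w"
  by (simp_all add: word_prod_def)

lemma word_prod_closed [simp]: "set w \<subseteq> carrier G \<Longrightarrow> word_prod G w \<in> carrier G"
  by (induction w) auto

lemma lists_carrier: "w \<in> lists Os \<Longrightarrow> set w \<subseteq> carrier G"
  using Os_subset by auto

lemma word_prod_append:
  "\<lbrakk>set u \<subseteq> carrier G; set v \<subseteq> carrier G\<rbrakk> \<Longrightarrow> word_prod G (u @ v) = word_prod G u \<otimes> word_prod G v"
  by (induction u) (auto simp: m_assoc)

lemma equiv_move_front:
  "\<lbrakk>w \<in> lists Os; g \<in> Os\<rbrakk> \<Longrightarrow> w @ [g] \<asymp> g # map (\<lambda>a. inv g \<otimes> a \<otimes> g) w"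
proof (induction w)
  case (Cons a w)
  then have "(a # w) @ [g] \<asymp> a # g # map (\<lambda>a. inv g \<otimes> a \<otimes> g) w"
    by (simp add: equiv_Cons)
  also have "\<dots> \<asymp> g # (inv g \<otimes> a \<otimes> g) # map (\<lambda>a. inv g \<otimes> a \<otimes> g) w"
    using Cons.prems by (intro equiv_swap_right) auto
  finally show ?case by simp
qed simp

text \<open>The counterpart of \<open>equiv_move_front\<close>: here the crossed letters stay as
  they are, and the moving letter is conjugated by each letter that it crosses, hence in the end by
  the product of \<open>w\<close>.\<close>

lemma equiv_move_front_conj:
  "\<lbrakk>w \<in> lists Os; g \<in> Os\<rbrakk> \<Longrightarrow> w @ [g] \<asymp> (word_prod G w \<otimes> g \<otimes> inv (word_prod G w)) # w"
proof (induction w)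
  case (Cons a w)
  let ?P = "word_prod G w"
  have P: "?P \<in> carrier G" using Cons.prems lists_carrier by (intro word_prod_closed) auto
  have "(a # w) @ [g] \<asymp> a # (?P \<otimes> g \<otimes> inv ?P) # w"
    using Cons by (simp add: equiv_Cons)
  also have "\<dots> \<asymp> (a \<otimes> (?P \<otimes> g \<otimes> inv ?P) \<otimes> inv a) # a # w"
    using Cons.prems P by (intro equiv_swap_left) auto
  also have "a \<otimes> (?P \<otimes> g \<otimes> inv ?P) \<otimes> inv a = word_prod G (a # w) \<otimes> g \<otimes> inv (word_prod G (a # w))"
    using Cons.prems P by (simp add: inv_mult_group m_assoc)
  finally show ?case .
qed simp

text \<open>A letter crossing \<open>w\<close> from right to left is conjugated by the product of
  \<open>w\<close>, so it passes unchanged when this product is \<open>\<one>\<close>. Words of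
  trivial product are therefore central in the factorization semigroup.\<close>

lemma equiv_commute:
  assumes "w \<in> lists Os" "word_prod G w = \<one>" "v \<in> lists Os"
  shows "w @ v \<asymp> v @ w"
  using assms(3)
proof (induction v)
  case (Cons g v)
  have "w @ g # v = (w @ [g]) @ v" by simp
  also have "\<dots> \<asymp> (g # w) @ v"
    using equiv_move_front_conj[OF assms(1), of g] Cons.hyps assms(2)
    by (intro equiv_append) simp_all
  also have "(g # w) @ v \<asymp> g # v @ w"
    using Cons by (simp add: equiv_Cons)
  finally show ?case by simp
qed simp

text \<open>A \<open>move2\<close> on \<open>g\<close>, \<open>h\<close> is the reverse of a
  \<open>move1\<close> on \<open>g \<otimes> h \<otimes> inv g\<close>, \<open>g\<close>, so it
  suffices to check the first move.\<close>

lemma equiv_invariant: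
  assumes "u \<asymp> v"
    and "\<And>xs g h ys. \<lbrakk>g \<in> Os; h \<in> Os\<rbrakk> \<Longrightarrow> f (xs @ [g, h] @ ys) = f (xs @ [h, inv h \<otimes> g \<otimes> h] @ ys)"
  shows "f u = f v"
  using assms(1) unfolding fact_equiv_def
proof (rule equivclp_invariant)
  fix x y assume "hurwitz_step G Os x y"
  then show "f x = f y"
  proof cases
    case (move2 g h xs ys)
    have "inv g \<otimes> (g \<otimes> h \<otimes> inv g) \<otimes> g = h" 
      using move2 by (simp add: m_assoc)
    with move2 assms(2)[of "g \<otimes> h \<otimes> inv g" g xs ys] show ?thesis by simp
  next
    case (move1 g h xs ys)
    with assms(2)[of g h xs ys] show ?thesis by simp
  qed
qed

lemma equiv_lists: "u \<asymp> v \<Longrightarrow> u \<in> lists Os \<longleftrightarrow> v \<in> lists Os"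
  by (rule equiv_invariant[where f = "\<lambda>w. w \<in> lists Os"]) auto

lemma equiv_length: "u \<asymp> v \<Longrightarrow> length u = length v"
  by (rule equiv_invariant) auto

lemma equiv_word_prod: 
  assumes "u \<asymp> v" "u \<in> lists Os" shows "word_prod G u = word_prod G v"
proof -
  \<comment> \<open>The contexts \<open>xs\<close> and \<open>ys\<close> of a move may contain
    letters outside \<open>Os\<close>, and even outside the carrier; the default value makes
    \<open>?f\<close> constant along such moves as well.\<close>
  let ?f = "\<lambda>w. if set w \<subseteq> Os then word_prod G w else undefined"
  have *: "?f u = ?f v"
    using assms(1)
  proof (rule equiv_invariant)
    fix xs g h ys assume gh: "g \<in> Os" "h \<in> Os"
    have "word_prod G (xs @ [g, h] @ ys) = word_prod G (xs @ [h, inv h \<otimes> g \<otimes> h] @ ys)"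
      if "set xs \<subseteq> Os" "set ys \<subseteq> Os"
    proof -
      have "set xs \<subseteq> carrier G" "set ys \<subseteq> carrier G" using that Os_subset by auto
      then show ?thesis
        using gh by (simp add: word_prod_append m_assoc)
    qed
    with gh show "?f (xs @ [g, h] @ ys) = ?f (xs @ [h, inv h \<otimes> g \<otimes> h] @ ys)" by auto
  qed
  with assms equiv_lists[OF assms(1)] show ?thesis by (auto split: if_splits)
qed

lemma equiv_generate:
  assumes "u \<asymp> v" "u \<in> lists Os" shows "generate G (set u) = generate G (set v)"
proof -
  let ?f = "\<lambda>w. if set w \<subseteq> Os then generate G (set w) else undefined"
  have *: "?f u = ?f v"
    using assms(1)
  proof (rule equiv_invariant)
    fix xs g h ys assume gh: "g \<in> Os" "h \<in> Os"
    have "generate G (set (xs @ [g, h] @ ys)) = generate G (set (xs @ [h, inv h \<otimes> g \<otimes> h] @ ys))"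
      (is "generate G ?A = generate G ?B")
      if "set xs \<subseteq> Os" "set ys \<subseteq> Os"
    proof -
      have A: "?A \<subseteq> carrier G" and B: "?B \<subseteq> carrier G" using that Os_subset gh by auto
      have "inv h \<otimes> g \<otimes> h \<in> generate G ?A"
        by (intro generate.eng generate.incl generate.inv) auto
      then have 1: "?B \<subseteq> generate G ?A" by (auto intro: generate.incl)
      have "h \<otimes> (inv h \<otimes> g \<otimes> h) \<otimes> inv h \<in> generate G ?B"
        by (intro generate.eng generate.incl generate.inv) auto
      also have "h \<otimes> (inv h \<otimes> g \<otimes> h) \<otimes> inv h = g"
        using gh by (simp add: m_assoc)
      finally have 2: "?A \<subseteq> generate G ?B" by (auto intro: generate.incl)
      show ?thesis
        using generate_subgroup_incl[OF 1 generate_is_subgroup[OF A]]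
          generate_subgroup_incl[OF 2 generate_is_subgroup[OF B]] by auto
    qed
    with gh show "?f (xs @ [g, h] @ ys) = ?f (xs @ [h, inv h \<otimes> g \<otimes> h] @ ys)" by auto
  qed
  with assms equiv_lists[OF assms(1)] show ?thesis by (auto split: if_splits)
qed

lemma equiv_count:
  assumes "u \<asymp> v" and C: "\<And>a g. \<lbrakk>a \<in> Os; g \<in> carrier G\<rbrakk> \<Longrightarrow> inv g \<otimes> a \<otimes> g \<in> C \<longleftrightarrow> a \<in> C"
  shows "length (filter (\<lambda>a. a \<in> C) u) = length (filter (\<lambda>a. a \<in> C) v)"
  using assms(1) by (rule equiv_invariant) (auto simp: C)

text \<open>The copies of \<open>g\<close> are pulled to the front one by one with
  \<open>equiv_move_front\<close>. Taking the first occurrence each time ensures that the conjugated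
  prefix contains no \<open>g\<close>, so no further copy is lost.\<close>

lemma equiv_extract:
  "\<lbrakk>w \<in> lists Os; g \<in> Os; k \<le> count_list w g\<rbrakk> \<Longrightarrow> \<exists>w'. w \<asymp> replicate k g @ w'"
proof (induction k arbitrary: w)
  case (Suc k)
  then have "g \<in> set w" by (metis count_notin not_less_eq_eq le0)
  then obtain u v where w: "w = u @ g # v" and u: "g \<notin> set u" by (meson split_list_first)
  let ?u = "map (\<lambda>a. inv g \<otimes> a \<otimes> g) u"
  have uv: "u \<in> lists Os" "v \<in> lists Os" using Suc.prems w by auto
  have "k \<le> count_list (?u @ v) g" using Suc.prems w u by simp
  moreover have "?u @ v \<in> lists Os" using uv Suc.prems(2) by auto
  ultimately obtain w' where w': "?u @ v \<asymp> replicate k g @ w'"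
    using Suc.IH[of "?u @ v"] Suc.prems(2) by blast
  have "w = (u @ [g]) @ v" using w by simp
  also have "\<dots> \<asymp> (g # ?u) @ v"
    by (intro equiv_append equiv_move_front uv Suc.prems) simp
  also have "\<dots> \<asymp> g # replicate k g @ w'" using equiv_Cons[OF w'] by simp
  finally show ?case by auto
next
  case 0
  show ?case by (rule exI[of _ w]) simp
qed

section \<open>The hat group\<close>

abbreviation hat_words :: "('a \<times> bool) list set" where "hat_words \<equiv> lists (Os \<times> UNIV)"

definition pos_word :: "'a list \<Rightarrow> ('a \<times> bool) list" where
  "pos_word w = map (\<lambda>g. (g, True)) w"

definition inv_word :: "('a \<times> bool) list \<Rightarrow> ('a \<times> bool) list" where
  "inv_word w = rev (map (\<lambda>(g, b). (g, \<not> b)) w)"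

lemma pos_word_simps [simp]:
  "pos_word [] = []" "pos_word (g # w) = (g, True) # pos_word w"
  "pos_word (u @ v) = pos_word u @ pos_word v"
  by (simp_all add: pos_word_def)

lemma inv_word_simps [simp]:
  "inv_word [] = []" "inv_word ((g, b) # w) = inv_word w @ [(g, \<not> b)]"
  by (simp_all add: inv_word_def)

lemma pos_word_hat_words [simp]: "w \<in> lists Os \<Longrightarrow> pos_word w \<in> hat_words"
  by (auto simp: pos_word_def)

lemma inv_word_hat_words [simp]: "w \<in> hat_words \<Longrightarrow> inv_word w \<in> hat_words"
  by (auto simp: inv_word_def)

lemma hat_refl [simp]: "u \<asymp>\<^sub>y u"
  by (simp add: hat_equiv_def)

lemma hat_sym: "u \<asymp>\<^sub>y v \<Longrightarrow> v \<asymp>\<^sub>y u"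
  unfolding hat_equiv_def by (rule equivclp_sym)

lemma hat_trans [trans]: "u \<asymp>\<^sub>y v \<Longrightarrow> v \<asymp>\<^sub>y w \<Longrightarrow> u \<asymp>\<^sub>y w"
  unfolding hat_equiv_def by (rule equivclp_trans)

lemma hat_context: "u \<asymp>\<^sub>y v \<Longrightarrow> a @ u @ b \<asymp>\<^sub>y a @ v @ b"
  unfolding hat_equiv_def
  by (erule equivclp_map[where f = "\<lambda>x. a @ x @ b"]) (blast intro: hat_step_context)

lemma hat_append:
  assumes "u \<asymp>\<^sub>y u'" "v \<asymp>\<^sub>y v'" shows "u @ v \<asymp>\<^sub>y u' @ v'"
proof -
  have "u @ v \<asymp>\<^sub>y u' @ v" using hat_context[OF assms(1), of "[]" v] by simp
  also have "\<dots> \<asymp>\<^sub>y u' @ v'" using hat_context[OF assms(2), of u' "[]"] by simp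
  finally show ?thesis .
qed

lemma hat_cancel: "g \<in> Os \<Longrightarrow> xs @ [(g, b), (g, \<not> b)] @ ys \<asymp>\<^sub>y xs @ ys"
  unfolding hat_equiv_def by (rule r_into_equivclp) (rule hat_step.cancel)

lemma hat_relator:
  "\<lbrakk>g \<in> Os; h \<in> Os\<rbrakk> \<Longrightarrow>
    xs @ [(h, False), (g, True), (h, True)] @ ys \<asymp>\<^sub>y xs @ [(inv h \<otimes> g \<otimes> h, True)] @ ys"
  unfolding hat_equiv_def by (rule r_into_equivclp) (rule hat_step.relator)

lemma inv_word_right: "w \<in> hat_words \<Longrightarrow> w @ inv_word w \<asymp>\<^sub>y []"
proof (induction w)
  case (Cons x w)
  obtain g b where x: "x = (g, b)" by (cases x)
  have "(x # w) @ inv_word (x # w) = [(g, b)] @ (w @ inv_word w) @ [(g, \<not> b)]" by (simp add: x)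
  also have "\<dots> \<asymp>\<^sub>y [(g, b)] @ [] @ [(g, \<not> b)]" using Cons by (intro hat_context) auto
  also have "\<dots> \<asymp>\<^sub>y []" using hat_cancel[of g "[]" b "[]"] Cons.prems x by simp
  finally show ?case .
qed simp

lemma inv_word_inv_word [simp]: "inv_word (inv_word w) = w"
  by (simp add: inv_word_def rev_map comp_def case_prod_beta)

lemma inv_word_left: "w \<in> hat_words \<Longrightarrow> inv_word w @ w \<asymp>\<^sub>y []"
  using inv_word_right[of "inv_word w"] by simp

lemma hat_step_hat_words: "hat_step G Os u v \<Longrightarrow> u \<in> hat_words \<longleftrightarrow> v \<in> hat_words"
  by (erule hat_step.cases) auto

text \<open>The rules of \<open>hat_step\<close> insert and delete only letters from
  \<open>Os\<close>, so a chain that starts in \<open>hat_words\<close> never leaves it. Each step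
  may then rely on the group laws for all letters.\<close>

lemma hat_equiv_induct [consumes 2, case_names base step]:
  assumes "u \<asymp>\<^sub>y v" "u \<in> hat_words" and "P u"
    and "\<And>y z. \<lbrakk>hat_step G Os y z \<or> hat_step G Os z y; y \<in> hat_words; z \<in> hat_words; P y\<rbrakk> \<Longrightarrow> P z"
  shows "P v"
proof -
  have "v \<in> hat_words \<and> P v"
    using assms(1) unfolding hat_equiv_def
  proof induction
    case (step y z)
    then show ?case using hat_step_hat_words assms(4) by blast
  qed (use assms(2,3) in blast)
  then show ?thesis ..
qed

lemma hat_invariant:
  assumes "u \<asymp>\<^sub>y v" "u \<in> hat_words"
    and "\<And>x y. \<lbrakk>hat_step G Os x y; x \<in> hat_words; y \<in> hat_words\<rbrakk> \<Longrightarrow> f x = f y"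
  shows "f u = f v"
  using assms(1,2)
proof (induction rule: hat_equiv_induct)
  case (step y z)
  from step.hyps(1) assms(3)[OF _ step.hyps(2,3)] assms(3)[OF _ step.hyps(3,2)] have "f y = f z"
    by (elim disjE) simp_all
  with step.IH show ?case by simp
qed simp

text \<open>In front of \<open>y_g y_h\<close> the trivial pair \<open>y_h y_h^-1\<close> is
  inserted; the relator then turns \<open>y_h^-1 y_g y_h\<close> into one generator, which is the
  first Hurwitz move. This gives the homomorphism from the factorization semigroup to the hat
  group.\<close>

lemma pos_word_equiv: "u \<asymp> v \<Longrightarrow> pos_word u \<asymp>\<^sub>y pos_word v"
proof -
  have right: "pos_word (xs @ [g, h] @ ys) \<asymp>\<^sub>y pos_word (xs @ [h, inv h \<otimes> g \<otimes> h] @ ys)"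
    if "g \<in> Os" "h \<in> Os" for xs ys g h
  proof -
    have "pos_word xs @ [(h, True), (h, \<not> True)] @ [(g, True), (h, True)] @ pos_word ys
        \<asymp>\<^sub>y pos_word xs @ [(g, True), (h, True)] @ pos_word ys"
      by (rule hat_cancel) fact
    from hat_sym[OF this]
    have "pos_word (xs @ [g, h] @ ys) \<asymp>\<^sub>y
        (pos_word xs @ [(h, True)]) @ [(h, False), (g, True), (h, True)] @ pos_word ys" by simp
    also have "\<dots> \<asymp>\<^sub>y (pos_word xs @ [(h, True)]) @ [(inv h \<otimes> g \<otimes> h, True)] @ pos_word ys"
      using that by (rule hat_relator)
    finally show ?thesis by simp
  qed
  assume "u \<asymp> v"
  then show ?thesis
    unfolding fact_equiv_def hat_equiv_def
  proof (rule equivclp_map)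
    fix x y assume "hurwitz_step G Os x y"
    then have "pos_word x \<asymp>\<^sub>y pos_word y"
    proof cases
      case (move1 g h xs ys)
      with right show ?thesis by blast
    next
      case (move2 g h xs ys)
      then have "inv g \<otimes> (g \<otimes> h \<otimes> inv g) \<otimes> g = h" by (simp add: m_assoc)
      with right[of "g \<otimes> h \<otimes> inv g" g xs ys] move2 show ?thesis by (intro hat_sym[of _ "pos_word x"]) simp
    qed
    then show "equivclp (hat_step G Os) (pos_word x) (pos_word y)" by (simp add: hat_equiv_def)
  qed
qed

text \<open>This is \<open>hat_beta\<close> computed on an arbitrary word of the class instead of
  the chosen one; the two are identified in \<open>hat_beta_hat_class\<close>.\<close>

definition word_value :: "('a \<times> bool) list \<Rightarrow> 'a" where
  "word_value w = word_prod G (map (hat_letter G) w)"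

lemma hat_letter_carrier: "w \<in> hat_words \<Longrightarrow> set (map (hat_letter G) w) \<subseteq> carrier G"
  by (auto simp: hat_letter_def)

lemma word_value_closed [simp]: "w \<in> hat_words \<Longrightarrow> word_value w \<in> carrier G"
  unfolding word_value_def by (intro word_prod_closed hat_letter_carrier)

lemma word_value_append:
  "\<lbrakk>u \<in> hat_words; v \<in> hat_words\<rbrakk> \<Longrightarrow> word_value (u @ v) = word_value u \<otimes> word_value v"
  using hat_letter_carrier[of u] hat_letter_carrier[of v] by (simp add: word_value_def word_prod_append)

lemma word_value_pos_word: "word_value (pos_word w) = word_prod G w"
  by (simp add: word_value_def pos_word_def hat_letter_def comp_def)

lemma word_value_equiv:
  assumes "u \<asymp>\<^sub>y v" "u \<in> hat_words" shows "word_value u = word_value v"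
  using assms
proof (rule hat_invariant)
  fix x y assume "hat_step G Os x y" and xy: "x \<in> hat_words" "y \<in> hat_words"
  then show "word_value x = word_value y"
  proof cases
    case (cancel g xs b ys)
    then have "xs \<in> hat_words" "ys \<in> hat_words" using xy by auto
    moreover have "word_value [(g, b), (g, \<not> b)] = \<one>"
      using cancel by (simp add: word_value_def hat_letter_def)
    ultimately show ?thesis using cancel by (simp add: word_value_append del: append.simps)
  next
    case (relator g h xs ys)
    then have "xs \<in> hat_words" "ys \<in> hat_words" using xy by auto
    moreover have "word_value [(h, False), (g, True), (h, True)] = word_value [(inv h \<otimes> g \<otimes> h, True)]"
      using relator by (simp add: word_value_def hat_letter_def m_assoc)
    ultimately show ?thesis using relator by (simp add: word_value_append del: append.simps)
  qed
qed

section \<open>Group structure on the classes of hat words\<close>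

abbreviation hatG :: "('a \<times> bool) list set monoid" where "hatG \<equiv> hat_group G Os"

lemma hat_class_eq_iff:
  assumes "u \<in> hat_words" "v \<in> hat_words"
  shows "hat_class G Os u = hat_class G Os v \<longleftrightarrow> u \<asymp>\<^sub>y v"
proof
  assume "hat_class G Os u = hat_class G Os v"
  moreover have "v \<in> hat_class G Os v" using assms by (simp add: hat_class_def)
  ultimately show "u \<asymp>\<^sub>y v" by (auto simp: hat_class_def)
next
  assume uv: "u \<asymp>\<^sub>y v"
  have "u \<asymp>\<^sub>y x \<longleftrightarrow> v \<asymp>\<^sub>y x" for x
    using hat_trans[OF uv] hat_trans[OF hat_sym[OF uv]] by blast
  then show "hat_class G Os u = hat_class G Os v" by (simp add: hat_class_def)
qed

text \<open>Products in \<open>hat_group\<close> and values of \<open>hat_beta\<close> are computed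
  on a \<open>SOME\<close> representative; this allows any given word of the class to take its
  place.\<close>

lemma hat_class_some:
  assumes "u \<in> hat_words"
  shows "(SOME a. a \<in> hat_class G Os u) \<in> hat_words \<and> u \<asymp>\<^sub>y (SOME a. a \<in> hat_class G Os u)"
proof -
  have "u \<in> hat_class G Os u" using assms by (simp add: hat_class_def)
  then have "(SOME a. a \<in> hat_class G Os u) \<in> hat_class G Os u" by (rule someI)
  then show ?thesis by (simp add: hat_class_def)
qed

lemma carrier_hatG: "carrier hatG = hat_class G Os ` hat_words"
  by (simp add: hat_group_def)

lemma hat_class_closed [simp]: "w \<in> hat_words \<Longrightarrow> hat_class G Os w \<in> carrier hatG"
  by (simp add: carrier_hatG)

lemma one_hatG: "\<one>\<^bsub>hatG\<^esub> = hat_class G Os []"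
  by (simp add: hat_group_def)

lemma mult_hatG:
  assumes "u \<in> hat_words" "v \<in> hat_words"
  shows "hat_class G Os u \<otimes>\<^bsub>hatG\<^esub> hat_class G Os v = hat_class G Os (u @ v)"
proof -
  let ?u = "SOME a. a \<in> hat_class G Os u" and ?v = "SOME a. a \<in> hat_class G Os v"
  have "u @ v \<asymp>\<^sub>y ?u @ ?v" and "?u @ ?v \<in> hat_words"
    using hat_class_some[OF assms(1)] hat_class_some[OF assms(2)] by (auto intro!: hat_append)
  then show ?thesis
    using hat_class_eq_iff[of "u @ v" "?u @ ?v"] assms by (simp add: hat_group_def)
qed

lemma group_hatG: "group hatG"
proof (rule groupI)
  fix x assume "x \<in> carrier hatG"
  then obtain u where u: "u \<in> hat_words" "x = hat_class G Os u" by (auto simp: carrier_hatG)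
  have "hat_class G Os (inv_word u) \<otimes>\<^bsub>hatG\<^esub> x = \<one>\<^bsub>hatG\<^esub>"
    using u hat_class_eq_iff[of "inv_word u @ u" "[]"] inv_word_left[OF u(1)]
    by (simp add: mult_hatG one_hatG)
  then show "\<exists>y\<in>carrier hatG. y \<otimes>\<^bsub>hatG\<^esub> x = \<one>\<^bsub>hatG\<^esub>"
    using u by (intro bexI[of _ "hat_class G Os (inv_word u)"]) auto
qed (unfold carrier_hatG, (elim imageE)?; simp add: mult_hatG one_hatG)+

lemma inv_hatG:
  assumes "w \<in> hat_words"
  shows "inv\<^bsub>hatG\<^esub> (hat_class G Os w) = hat_class G Os (inv_word w)"
proof (rule group.inv_equality[OF group_hatG])
  show "hat_class G Os (inv_word w) \<otimes>\<^bsub>hatG\<^esub> hat_class G Os w = \<one>\<^bsub>hatG\<^esub>"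
    using assms hat_class_eq_iff[of "inv_word w @ w" "[]"] inv_word_left[OF assms]
    by (simp add: mult_hatG one_hatG)
qed (use assms in simp_all)

lemma hat_beta_hat_class: 
  assumes "w \<in> hat_words" shows "hat_beta G (hat_class G Os w) = word_value w"
  using hat_class_some[OF assms] word_value_equiv[OF _ assms]
  unfolding hat_beta_def word_value_def by metis

end

section \<open>Splitting off central powers\<close>

lemma (in group) conj_class_eq_if_mem:
  assumes "x \<in> carrier G" "a \<in> conj_class G x" shows "conj_class G x = conj_class G a"
proof -
  from assms obtain k where k: "k \<in> carrier G" "a = inv k \<otimes> x \<otimes> k"
    by (auto simp: conj_class_def)
  have "\<exists>h\<in>carrier G. inv g \<otimes> x \<otimes> g = inv h \<otimes> a \<otimes> h" if g: "g \<in> carrier G" for g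
    using k g assms(1) by (intro bexI[of _ "inv k \<otimes> g"]) (simp_all add: inv_mult_group m_assoc)
  moreover have "\<exists>h\<in>carrier G. inv g \<otimes> a \<otimes> g = inv h \<otimes> x \<otimes> h" if g: "g \<in> carrier G" for g
    using k g assms(1) by (intro bexI[of _ "k \<otimes> g"]) (simp_all add: inv_mult_group m_assoc)
  ultimately show ?thesis
    unfolding conj_class_def by blast
qed

abbreviation letters_in :: "'a set \<Rightarrow> 'a list \<Rightarrow> nat" where
  "letters_in C w \<equiv> length (filter (\<lambda>a. a \<in> C) w)"

locale finite_equipped_group = conj_invariant_subset G Os for G (structure) and Os +
  fixes Cs :: "'a set list"
  assumes equipped: "equipped G Cs"
    and Os_eq: "Os = \<Union>(set Cs)"
    and finite_carrier: "finite (carrier G)"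
    and generate_Os: "generate G Os = carrier G"
begin

lemma class_subset: "C \<in> set Cs \<Longrightarrow> C \<subseteq> Os"
  by (auto simp: Os_eq)

lemma class_eq: "\<lbrakk>C \<in> set Cs; a \<in> C\<rbrakk> \<Longrightarrow> C = conj_class G a"
  using equipped conj_class_eq_if_mem unfolding equipped_def by metis

lemma class_unique: "\<lbrakk>C \<in> set Cs; D \<in> set Cs; a \<in> C; a \<in> D\<rbrakk> \<Longrightarrow> C = D"
  using class_eq by blast

lemma class_conj_iff:
  assumes "C \<in> set Cs" "a \<in> Os" "g \<in> carrier G"
  shows "inv g \<otimes> a \<otimes> g \<in> C \<longleftrightarrow> a \<in> C"
proof -
  obtain D where D: "D \<in> set Cs" "a \<in> D" using assms(2) Os_eq by blast
  then have "inv g \<otimes> a \<otimes> g \<in> D"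
    using class_eq[OF D] assms(3) by (auto simp: conj_class_def)
  then show ?thesis using class_unique[OF assms(1) D(1)] D(2) by blast
qed

lemma finite_Os: "finite Os"
  using Os_subset finite_carrier finite_subset by blast

lemma order_pos: "0 < order G"
  using finite_carrier order_gt_0_iff_finite by blast

lemma card_class_le: "C \<in> set Cs \<Longrightarrow> card C \<le> order G"
  unfolding order_def using class_subset Os_subset by (intro card_mono finite_carrier) blast

lemma equiv_letters_in: "\<lbrakk>u \<asymp> v; C \<in> set Cs\<rbrakk> \<Longrightarrow> letters_in C u = letters_in C v"
  by (rule equiv_count) (auto simp: class_conj_iff)

text \<open>The product of the powers \<open>x_g^n\<close> for \<open>g\<close> in \<open>L\<close>,
  where \<open>n = order G\<close>. Since \<open>g^n = \<one>\<close>, these words are central, and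
  concatenating the lists multiplies the products.\<close>

definition cycles :: "'a list \<Rightarrow> 'a list" where
  "cycles L = concat (map (replicate (order G)) L)"

lemma cycles_Nil [simp]: "cycles [] = []"
  and cycles_Cons: "cycles (g # L) = replicate (order G) g @ cycles L"
  and cycles_append: "cycles (L @ M) = cycles L @ cycles M"
  by (simp_all add: cycles_def)

lemma cycles_lists [simp]: "L \<in> lists Os \<Longrightarrow> cycles L \<in> lists Os"
  by (auto simp: cycles_def)

lemma word_prod_replicate: "g \<in> carrier G \<Longrightarrow> word_prod G (replicate k g) = g [^] k"
  by (induction k) (simp_all flip: nat_pow_Suc2)

lemma word_prod_cycles: "L \<in> lists Os \<Longrightarrow> word_prod G (cycles L) = \<one>"
proof (induction L)
  case (Cons g L)
  then have "word_prod G (cycles (g # L)) = word_prod G (replicate (order G) g) \<otimes> word_prod G (cycles L)"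
    unfolding cycles_Cons by (intro word_prod_append lists_carrier) auto
  with Cons show ?case by (simp add: word_prod_replicate pow_order_eq_1)
qed simp

lemma cycles_commute: "\<lbrakk>L \<in> lists Os; v \<in> lists Os\<rbrakk> \<Longrightarrow> cycles L @ v \<asymp> v @ cycles L"
  by (intro equiv_commute word_prod_cycles cycles_lists)

lemma cycles_commute_context:
  assumes "L \<in> lists Os" "v \<in> lists Os" shows "cycles L @ v @ w \<asymp> v @ cycles L @ w"
  using equiv_append[OF cycles_commute[OF assms], of w w] by simp

text \<open>The central power \<open>x_h^n\<close> is moved next to an occurrence of
  \<open>a\<close>, then \<open>a\<close> is pulled through it, which conjugates all its letters by
  \<open>a\<close>. The result is again a central power and returns to the front.\<close>

lemma cycle_conj_letter:
  assumes w: "w \<in> lists Os" and "a \<in> set w" and h: "h \<in> Os"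
  shows "replicate (order G) h @ w \<asymp> replicate (order G) (inv a \<otimes> h \<otimes> a) @ w"
proof -
  obtain p q where w_eq: "w = p @ a # q" using assms(2) by (meson split_list)
  have pq: "p \<in> lists Os" "a \<in> Os" "q \<in> lists Os" using w w_eq by auto
  let ?h = "inv a \<otimes> h \<otimes> a"
  have h': "?h \<in> Os" using pq h by simp
  have "replicate (order G) h @ w \<asymp> p @ replicate (order G) h @ a # q"
    using cycles_commute_context[of "[h]" p "a # q"] h pq by (simp add: w_eq cycles_Cons)
  also have "\<dots> = p @ (replicate (order G) h @ [a]) @ q" by simp
  also have "\<dots> \<asymp> p @ (a # map (\<lambda>g. inv a \<otimes> g \<otimes> a) (replicate (order G) h)) @ q"
    using pq h by (intro equiv_context equiv_move_front) auto
  also have "\<dots> = (p @ [a]) @ replicate (order G) ?h @ q" by simp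
  also have "\<dots> \<asymp> replicate (order G) ?h @ (p @ [a]) @ q"
    using equiv_sym[OF cycles_commute_context[of "[?h]" "p @ [a]" q]] h' pq
    by (simp add: cycles_Cons)
  finally show ?thesis by (simp add: w_eq)
qed

text \<open>Induction over the generated subgroup. For the inverse of a letter \<open>a\<close>,
  \<open>cycle_conj_letter\<close> is applied to \<open>a \<otimes> h \<otimes> inv a\<close> and
  read backwards.\<close>

lemma cycle_conj:
  assumes w: "w \<in> lists Os" and "x \<in> generate G (set w)"
  shows "h \<in> Os \<Longrightarrow> replicate (order G) h @ w \<asymp> replicate (order G) (inv x \<otimes> h \<otimes> x) @ w"
  using assms(2)
proof (induction arbitrary: h)
  case one
  then show ?case by simp
next
  case (incl a)
  then show ?case by (intro cycle_conj_letter w)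
next
  case (inv a)
  then have a: "a \<in> carrier G" using w by auto
  have "replicate (order G) (a \<otimes> h \<otimes> inv a) @ w \<asymp> replicate (order G) h @ w"
    using cycle_conj_letter[OF w inv(1) conj_closed'[OF inv(2) a]] inv(2) a by (simp add: m_assoc)
  from equiv_sym[OF this] show ?case using a by simp
next
  case (eng x y)
  have xy: "x \<in> carrier G" "y \<in> carrier G"
    using eng generate_in_carrier[OF lists_carrier[OF w]] by auto
  have "replicate (order G) h @ w \<asymp> replicate (order G) (inv x \<otimes> h \<otimes> x) @ w"
    by (rule eng.IH(1)) (use eng in auto)
  also have "\<dots> \<asymp> replicate (order G) (inv y \<otimes> (inv x \<otimes> h \<otimes> x) \<otimes> y) @ w"
    by (rule eng.IH(2)) (use eng xy in auto)
  finally show ?case using xy eng.prems by (simp add: inv_mult_group m_assoc)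
qed

definition spanning :: "'a list \<Rightarrow> bool" where
  "spanning w \<longleftrightarrow> w \<in> lists Os \<and> generate G (set w) = carrier G"

lemma spanning_lists [simp]: "spanning w \<Longrightarrow> w \<in> lists Os"
  by (simp add: spanning_def)

lemma spanning_equiv: "u \<asymp> v \<Longrightarrow> spanning u \<longleftrightarrow> spanning v"
proof -
  assume uv: "u \<asymp> v"
  show ?thesis
    unfolding spanning_def equiv_lists[OF uv] using equiv_generate[OF uv] equiv_lists[OF uv] by metis
qed

lemma spanning_append:
  assumes "spanning w" "u \<in> lists Os" shows "spanning (u @ w)"
proof -
  have "generate G (set w) \<subseteq> generate G (set (u @ w))" by (intro mono_generate) auto
  moreover have "generate G (set (u @ w)) \<subseteq> carrier G"
    using assms lists_carrier[of "u @ w"] by (intro generate_incl) (simp add: spanning_def)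
  ultimately show ?thesis using assms by (auto simp: spanning_def)
qed

text \<open>A class has at most \<open>order G\<close> elements, so by the pigeonhole principle some
  \<open>h\<close> in \<open>C\<close> occurs more than \<open>order G\<close> times. A cycle of
  \<open>h\<close> is split off and changed by \<open>cycle_conj\<close> into the cycle of the
  prescribed conjugate \<open>g\<close>.\<close>

lemma split_cycle:
  assumes w: "spanning w" and C: "C \<in> set Cs" "g \<in> C"
    and large: "order G * order G < letters_in C w"
  shows "\<exists>w'. w \<asymp> replicate (order G) g @ w' \<and> spanning w'"
proof -
  have "finite C" using class_subset[OF C(1)] finite_Os finite_subset by blast
  moreover have "card C * order G < letters_in C w"
    using mult_le_mono1[OF card_class_le[OF C(1)], of "order G"] large by linarith
  ultimately obtain h where h: "h \<in> C" "order G < count_list w h"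
    using pigeonhole_count_list by blast
  have hg: "h \<in> Os" "g \<in> Os" using h C class_subset by auto
  \<comment> \<open>One copy more than the cycle takes: it stays in the remainder
    \<open>h # u\<close>, which thus has the same set of letters as the whole word and still
    generates the group.\<close>
  obtain u where u: "w \<asymp> replicate (Suc (order G)) h @ u"
    using equiv_extract[of w h "Suc (order G)"] w h hg by auto
  have w': "w \<asymp> replicate (order G) h @ h # u"
    using u by (simp add: replicate_app_Cons_same)
  with w have *: "spanning (replicate (order G) h @ h # u)"
    by (simp add: spanning_equiv)
  have "set (replicate (order G) h @ h # u) = set (h # u)" by auto
  with * have span: "spanning (h # u)" unfolding spanning_def by (simp add: in_lists_conv_set)
  obtain x where x: "x \<in> carrier G" "g = inv x \<otimes> h \<otimes> x"
    using class_eq[OF C(1) h(1)] C(2) by (auto simp: conj_class_def)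
  note w'
  also have "replicate (order G) h @ h # u \<asymp> replicate (order G) g @ h # u"
    unfolding x(2) using span x(1) hg(1) by (intro cycle_conj) (simp_all add: spanning_def)
  finally show ?thesis using span by blast
qed

text \<open>Each single split needs strictly more than \<open>order G * order G\<close> letters of
  the class. The letters of the cycle about to be split off provide this surplus, so the reserve is
  intact after every step.\<close>

lemma split_cycles:
  assumes "spanning w" "L \<in> lists Os"
    and "\<And>C. C \<in> set Cs \<Longrightarrow> order G * order G + letters_in C (cycles L) \<le> letters_in C w"
  shows "\<exists>w'. w \<asymp> cycles L @ w' \<and> spanning w'"
  using assms
proof (induction L arbitrary: w)
  case Nil
  then show ?case by (intro exI[of _ w]) simp
next
  case (Cons g L)
  obtain C where C: "C \<in> set Cs" "g \<in> C" using Cons.prems(2) Os_eq by auto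
  have "order G * order G < letters_in C w"
    using Cons.prems(3)[OF C(1)] C(2) order_pos by (simp add: cycles_Cons)
  then obtain w1 where w1: "w \<asymp> replicate (order G) g @ w1" "spanning w1"
    using split_cycle[OF Cons.prems(1) C] by blast
  have "\<exists>w'. w1 \<asymp> cycles L @ w' \<and> spanning w'"
  proof (rule Cons.IH)
    fix D assume D: "D \<in> set Cs"
    show "order G * order G + letters_in D (cycles L) \<le> letters_in D w1"
      using Cons.prems(3)[OF D] equiv_letters_in[OF w1(1) D] by (simp add: cycles_Cons)
  qed (use w1 Cons.prems in auto)
  then obtain w' where w': "w1 \<asymp> cycles L @ w'" "spanning w'" by blast
  have "w \<asymp> cycles (g # L) @ w'"
    using equiv_trans[OF w1(1) equiv_append[OF equiv_refl w'(1)]] by (simp add: cycles_Cons)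
  with w'(2) show ?case by blast
qed

text \<open>Equality after the central powers \<open>x_g^n\<close> have been inverted.\<close>

definition stably_equiv :: "'a list \<Rightarrow> 'a list \<Rightarrow> bool" where
  "stably_equiv u v \<longleftrightarrow> (\<exists>L\<in>lists Os. cycles L @ u \<asymp> cycles L @ v)"

lemma stably_equiv_letters_in:
  "\<lbrakk>stably_equiv u v; C \<in> set Cs\<rbrakk> \<Longrightarrow> letters_in C u = letters_in C v"
  using equiv_letters_in by (fastforce simp: stably_equiv_def)

lemma stably_equiv_cancel:
  assumes "stably_equiv u v" "u \<asymp> cycles L @ u'" "v \<asymp> cycles L @ v'" "L \<in> lists Os"
  shows "stably_equiv u' v'"
proof -
  obtain M where M: "M \<in> lists Os" "cycles M @ u \<asymp> cycles M @ v"
    using assms(1) by (auto simp: stably_equiv_def)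
  have "cycles (M @ L) @ u' \<asymp> cycles M @ u"
    using equiv_append[OF equiv_refl equiv_sym[OF assms(2)], of "cycles M"] by (simp add: cycles_append)
  also have "\<dots> \<asymp> cycles M @ v" by (rule M)
  also have "\<dots> \<asymp> cycles (M @ L) @ v'"
    using equiv_append[OF equiv_refl assms(3), of "cycles M"] by (simp add: cycles_append)
  finally show ?thesis using M assms(4) unfolding stably_equiv_def by (intro bexI[of _ "M @ L"]) auto
qed

text \<open>The stabilizing lists of the single pairs are concatenated. As cycles are central, the
  factor that belongs to a given pair can be brought next to it.\<close>

lemma uniform_stabilizer_finite:
  assumes "finite Q" "Q \<subseteq> {(u, v). stably_equiv u v}"
  shows "\<exists>L\<in>lists Os. \<forall>(u, v)\<in>Q. cycles L @ u \<asymp> cycles L @ v"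
  using assms
proof (induction Q)
  case empty
  show ?case by (rule bexI[of _ "[]"]) auto
next
  case (insert q Q)
  then obtain L where L: "L \<in> lists Os" "\<forall>(u, v)\<in>Q. cycles L @ u \<asymp> cycles L @ v" by auto
  obtain a b where q: "q = (a, b)" by (cases q)
  then obtain M where M: "M \<in> lists Os" "cycles M @ a \<asymp> cycles M @ b"
    using insert.prems by (auto simp: stably_equiv_def)
  have 1: "cycles (L @ M) @ a \<asymp> cycles (L @ M) @ b"
    using equiv_append[OF equiv_refl M(2)] by (simp add: cycles_append)
  have 2: "cycles (L @ M) @ u \<asymp> cycles (L @ M) @ v" if "(u, v) \<in> Q" for u v
  proof -
    have "cycles (L @ M) @ u \<asymp> cycles M @ cycles L @ u"
      using cycles_commute_context[of L "cycles M" u] L M by (simp add: cycles_append)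
    also have "\<dots> \<asymp> cycles M @ cycles L @ v"
      by (rule equiv_append[OF equiv_refl]) (use L(2) that in auto)
    also have "\<dots> \<asymp> cycles (L @ M) @ v"
      using cycles_commute_context[of M "cycles L" v] L M by (simp add: cycles_append)
    finally show ?thesis .
  qed
  show ?case
    using 1 2 L(1) M(1) q by (intro bexI[of _ "L @ M"]) auto
qed

text \<open>Only finitely many pairs of words contain no cycle that can be split off; all other
  pairs are reduced to these by splitting off the same cycle on both sides.\<close>

lemma uniform_stabilizer:
  "\<exists>L\<in>lists Os. \<forall>u v. spanning u \<longrightarrow> spanning v \<longrightarrow> stably_equiv u v \<longrightarrow>
     (\<forall>C\<in>set Cs. order G * order G \<le> letters_in C u) \<longrightarrow> cycles L @ u \<asymp> cycles L @ v"
proof -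
  \<comment> \<open>By the pigeonhole principle a longer word over \<open>Os\<close> has a letter
    occurring more than \<open>order G * order G + order G\<close> times: one cycle can be split
    off, and the reserve demanded by \<open>split_cycles\<close> remains.\<close>
  let ?B = "card Os * (order G * order G + order G)"
  let ?W = "{w. w \<in> lists Os \<and> length w \<le> ?B}"
  let ?Q = "{(u, v)\<in>?W \<times> ?W. stably_equiv u v}"
  have "finite ?W"
    using finite_lists_length_le[OF finite_Os, of ?B] by (simp add: lists_eq_set conj_commute)
  then have "finite ?Q" by (intro finite_subset[of ?Q "?W \<times> ?W"]) auto
  moreover have "?Q \<subseteq> {(u, v). stably_equiv u v}" by auto
  ultimately obtain L where L: "L \<in> lists Os" "\<forall>(u, v)\<in>?Q. cycles L @ u \<asymp> cycles L @ v"
    by (rule uniform_stabilizer_finite[THEN bexE])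
  have "cycles L @ u \<asymp> cycles L @ v"
    if "spanning u" "spanning v" "stably_equiv u v"
      "\<And>C. C \<in> set Cs \<Longrightarrow> order G * order G \<le> letters_in C u" for u v
    using that
  proof (induction "length u" arbitrary: u v rule: less_induct)
    case less
    note counts = stably_equiv_letters_in[OF less.prems(3)]
    obtain M where "cycles M @ u \<asymp> cycles M @ v" using less.prems(3) by (auto simp: stably_equiv_def)
    from equiv_length[OF this] have len: "length v = length u" by simp
    show ?case
    proof (cases "length u \<le> ?B")
      case True
      then have "(u, v) \<in> ?Q" using less.prems len by simp
      from bspec[OF L(2) this] show ?thesis by simp
    next
      case False
      have "filter (\<lambda>a. a \<in> Os) u = u" using less.prems(1) by (auto simp: filter_id_conv spanning_def)
      with False have "?B < letters_in Os u" by simp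
      from pigeonhole_count_list[OF finite_Os this]
      obtain g where g: "g \<in> Os" "order G * order G + order G < count_list u g" by blast
      have big: "order G * order G + letters_in C (cycles [g]) \<le> letters_in C u" if C: "C \<in> set Cs" for C
      proof (cases "g \<in> C")
        case True
        have "count_list u g \<le> letters_in C u"
          unfolding count_list_eq_length_filter using True by (induction u) auto
        with g True show ?thesis by (simp add: cycles_Cons)
      qed (use less.prems(4)[OF C] in \<open>simp add: cycles_Cons\<close>)
      have big': "order G * order G + letters_in C (cycles [g]) \<le> letters_in C v" if "C \<in> set Cs" for C
        using big[OF that] counts[OF that] by simp
      have g': "[g] \<in> lists Os" using g(1) by simp
      obtain u' where u': "u \<asymp> cycles [g] @ u'" "spanning u'"
        using split_cycles[OF less.prems(1) g' big] by blast
      obtain v' where v': "v \<asymp> cycles [g] @ v'" "spanning v'"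
        using split_cycles[OF less.prems(2) g' big'] by blast
      have "cycles L @ u' \<asymp> cycles L @ v'"
      proof (rule less.hyps)
        show "length u' < length u" using equiv_length[OF u'(1)] order_pos by (simp add: cycles_Cons)
        show "stably_equiv u' v'"
          by (rule stably_equiv_cancel[OF less.prems(3) u'(1) v'(1) g'])
        show "order G * order G \<le> letters_in C u'" if "C \<in> set Cs" for C
          using big[OF that] equiv_letters_in[OF u'(1) that] by simp
      qed (fact u' v')+
      then have *: "cycles [g] @ cycles L @ u' \<asymp> cycles [g] @ cycles L @ v'"
        by (rule equiv_append[OF equiv_refl])
      have "cycles L @ u \<asymp> cycles L @ cycles [g] @ u'" by (rule equiv_append[OF equiv_refl u'(1)])
      also have "\<dots> \<asymp> cycles [g] @ cycles L @ u'"
        using L g by (intro cycles_commute_context) auto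
      also note *
      also have "cycles [g] @ cycles L @ v' \<asymp> cycles L @ cycles [g] @ v'"
        using L g by (intro cycles_commute_context) auto
      also have "\<dots> \<asymp> cycles L @ v" by (rule equiv_append[OF equiv_refl equiv_sym[OF v'(1)]])
      finally show ?thesis .
    qed
  qed
  note reduced = this
  show ?thesis
  proof (intro bexI[OF _ L(1)] allI impI)
    fix u v
    assume *: "spanning u" "spanning v" "stably_equiv u v"
      and large: "\<forall>C\<in>set Cs. order G * order G \<le> letters_in C u"
    show "cycles L @ u \<asymp> cycles L @ v"
      by (rule reduced[OF * bspec[OF large]])
  qed
qed

text \<open>With the uniform \<open>L\<close>, \<open>cycles L\<close> is split off from both words.
  The remainders are stably equivalent and keep \<open>order G * order G\<close> letters of each
  class, so putting \<open>cycles L\<close> back in front makes them equal. The bound is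
  \<open>order G * order G + length (cycles L)\<close>.\<close>

lemma stably_equiv_imp_equiv:
  "\<exists>T. \<forall>u v. spanning u \<longrightarrow> spanning v \<longrightarrow> stably_equiv u v \<longrightarrow>
     (\<forall>C\<in>set Cs. T \<le> letters_in C u) \<longrightarrow> u \<asymp> v"
proof -
  obtain L where L: "L \<in> lists Os"
    and uniform: "\<forall>u v. spanning u \<longrightarrow> spanning v \<longrightarrow> stably_equiv u v \<longrightarrow>
     (\<forall>C\<in>set Cs. order G * order G \<le> letters_in C u) \<longrightarrow> cycles L @ u \<asymp> cycles L @ v"
    using uniform_stabilizer by blast
  show ?thesis
  proof (intro exI allI impI)
    fix u v
    assume u: "spanning u" and v: "spanning v" and uv: "stably_equiv u v"
      and large: "\<forall>C\<in>set Cs. order G * order G + length (cycles L) \<le> letters_in C u"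
    have big: "order G * order G + letters_in C (cycles L) \<le> letters_in C u" if "C \<in> set Cs" for C
      using bspec[OF large that] length_filter_le[of "\<lambda>a. a \<in> C" "cycles L"] by linarith
    obtain u' where u': "u \<asymp> cycles L @ u'" "spanning u'"
      using split_cycles[OF u L big] by blast
    have big': "order G * order G + letters_in C (cycles L) \<le> letters_in C v" if "C \<in> set Cs" for C
      using big[OF that] stably_equiv_letters_in[OF uv that] by simp
    obtain v' where v': "v \<asymp> cycles L @ v'" "spanning v'"
      using split_cycles[OF v L big'] by blast
    have "cycles L @ u' \<asymp> cycles L @ v'"
    proof (rule uniform[rule_format])
      show "stably_equiv u' v'" by (rule stably_equiv_cancel[OF uv u'(1) v'(1) L])
      show "order G * order G \<le> letters_in C u'" if "C \<in> set Cs" for C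
        using big[OF that] equiv_letters_in[OF u'(1) that] by simp
    qed (fact u' v')+
    with u'(1) have "u \<asymp> cycles L @ v'" by (rule equiv_trans)
    then show "u \<asymp> v" using equiv_sym[OF v'(1)] by (rule equiv_trans)
  qed
qed

section \<open>The hat group as a localization of the semigroup\<close>

text \<open>With \<open>n = order G\<close>, each \<open>y_g^-1\<close> is the fraction of
  \<open>y_g^(n-1)\<close> by the central \<open>y_g^n\<close>. This is the numerator of a hat word;
  \<open>neg_letters\<close> lists the \<open>g\<close> whose powers form the denominator.\<close>

definition pos_part :: "('a \<times> bool) list \<Rightarrow> 'a list" where
  "pos_part w = concat (map (\<lambda>(g, b). if b then [g] else replicate (order G - 1) g) w)"

definition neg_letters :: "('a \<times> bool) list \<Rightarrow> 'a list" where
  "neg_letters w = map fst (filter (\<lambda>x. \<not> snd x) w)"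

lemma pos_part_simps [simp]:
  "pos_part [] = []" "pos_part (u @ v) = pos_part u @ pos_part v"
  "pos_part ((g, True) # w) = g # pos_part w"
  "pos_part ((g, False) # w) = replicate (order G - 1) g @ pos_part w"
  by (simp_all add: pos_part_def)

lemma neg_letters_simps [simp]:
  "neg_letters [] = []" "neg_letters (u @ v) = neg_letters u @ neg_letters v"
  "neg_letters ((g, True) # w) = neg_letters w"
  "neg_letters ((g, False) # w) = g # neg_letters w"
  by (simp_all add: neg_letters_def)

lemma pos_part_lists [simp]: "w \<in> hat_words \<Longrightarrow> pos_part w \<in> lists Os"
  by (fastforce simp: pos_part_def split: if_splits)

lemma neg_letters_lists [simp]: "w \<in> hat_words \<Longrightarrow> neg_letters w \<in> lists Os"
  by (fastforce simp: neg_letters_def)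

lemma pos_part_pos_word [simp]: "pos_part (pos_word w) = w"
  by (induction w) auto

lemma neg_letters_pos_word [simp]: "neg_letters (pos_word w) = []"
  by (induction w) auto

lemma replicate_cycle: "replicate (order G - 1) g @ g # w = replicate (order G) g @ w"
  and Cons_replicate_cycle: "g # replicate (order G - 1) g @ w = replicate (order G) g @ w"
proof -
  obtain k where "order G = Suc k" using order_pos gr0_conv_Suc by blast
  then show "replicate (order G - 1) g @ g # w = replicate (order G) g @ w"
    and "g # replicate (order G - 1) g @ w = replicate (order G) g @ w"
    by (simp_all add: replicate_app_Cons_same)
qed

lemma cycles_collect:
  assumes "L \<in> lists Os" "M \<in> lists Os" "g \<in> Os" "p \<in> lists Os"
  shows "cycles (L @ M) @ p @ replicate (order G) g @ q \<asymp> cycles (L @ g # M) @ p @ q"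
proof -
  have "cycles [g] @ (cycles M @ p) @ q \<asymp> (cycles M @ p) @ cycles [g] @ q"
    using assms by (intro cycles_commute_context) simp_all
  from equiv_append[OF equiv_refl equiv_sym[OF this], of "cycles L"]
  show ?thesis by (simp add: cycles_append cycles_Cons)
qed

text \<open>Equality of the two fractions, cross-multiplied. In a cancelled pair, numerator and
  inverse letter together form a full cycle of \<open>g\<close>. For the relator, a Hurwitz move on
  \<open>g\<close>, \<open>h\<close> completes the preceding \<open>order G - 1\<close> copies of
  \<open>h\<close> to a full cycle.\<close>

lemma hat_step_pos_part:
  assumes "hat_step G Os u v" "u \<in> hat_words" "v \<in> hat_words"
  shows "cycles (neg_letters v) @ pos_part u \<asymp> cycles (neg_letters u) @ pos_part v"
  using assms(1)
proof cases
  case (cancel g xs b ys)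
  have w: "xs \<in> hat_words" "ys \<in> hat_words" using assms cancel by auto
  show ?thesis
    using cycles_collect[of "neg_letters xs" "neg_letters ys" g "pos_part xs" "pos_part ys"] w cancel
    by (cases b) (simp_all add: replicate_cycle Cons_replicate_cycle del: One_nat_def)
next
  case (relator g h xs ys)
  have w: "xs \<in> hat_words" "ys \<in> hat_words" using assms relator by auto
  let ?k = "inv h \<otimes> g \<otimes> h"
  let ?N = "neg_letters xs @ neg_letters ys"
  have "(cycles ?N @ pos_part xs @ replicate (order G - 1) h) @ g # h # pos_part ys
      \<asymp> (cycles ?N @ pos_part xs @ replicate (order G - 1) h) @ h # ?k # pos_part ys"
    using relator by (intro equiv_append[OF equiv_refl] equiv_swap_right)
  also have "\<dots> = cycles ?N @ pos_part xs @ replicate (order G) h @ ?k # pos_part ys"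
    by (simp only: append_assoc replicate_cycle)
  also have "\<dots> \<asymp> cycles (neg_letters xs @ h # neg_letters ys) @ pos_part xs @ ?k # pos_part ys"
    using w relator by (intro cycles_collect) simp_all
  finally show ?thesis using relator by simp
qed

text \<open>The cross-multiplied equalities of the single steps are composed. The denominator of the
  intermediate word is not cancelled but collected in \<open>M\<close>.\<close>

lemma hat_equiv_pos_part:
  assumes "u \<asymp>\<^sub>y v" "u \<in> hat_words"
  shows "\<exists>M\<in>lists Os. cycles (M @ neg_letters v) @ pos_part u \<asymp> cycles (M @ neg_letters u) @ pos_part v"
  using assms
proof (induction rule: hat_equiv_induct)
  case base
  show ?case by (rule bexI[of _ "[]"]) simp_all
next
  case (step y z)
  let ?n = "\<lambda>w. cycles (neg_letters w)"
  from step.IH obtain M where M: "M \<in> lists Os"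
    "cycles (M @ neg_letters y) @ pos_part u \<asymp> cycles (M @ neg_letters u) @ pos_part y" by blast
  have yz: "?n z @ pos_part y \<asymp> ?n y @ pos_part z"
    using step.hyps(1)
  proof
    assume "hat_step G Os y z"
    then show ?thesis using step.hyps by (intro hat_step_pos_part)
  next
    assume "hat_step G Os z y"
    from equiv_sym[OF hat_step_pos_part[OF this step.hyps(3,2)]] show ?thesis .
  qed
  have n: "neg_letters y \<in> lists Os" "neg_letters z \<in> lists Os" "neg_letters u \<in> lists Os"
    using step.hyps assms(2) by simp_all
  then have c: "cycles M \<in> lists Os" "?n y \<in> lists Os" "?n z \<in> lists Os" "?n u \<in> lists Os"
    using M(1) by simp_all
  have swap: "cycles L @ cycles L' @ w \<asymp> cycles L' @ cycles L @ w" if "L \<in> lists Os" "L' \<in> lists Os" for L L' w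
    using that by (intro cycles_commute_context cycles_lists)
  have "cycles M @ ?n y @ ?n z @ pos_part u \<asymp> cycles M @ ?n z @ ?n y @ pos_part u"
    by (rule equiv_append[OF equiv_refl swap[OF n(1,2)]])
  also have "\<dots> \<asymp> ?n z @ cycles M @ ?n y @ pos_part u" by (rule swap[OF M(1) n(2)])
  also have "\<dots> \<asymp> ?n z @ cycles M @ ?n u @ pos_part y"
    using equiv_append[OF equiv_refl M(2)] by (simp add: cycles_append)
  also have "\<dots> \<asymp> cycles M @ ?n z @ ?n u @ pos_part y" by (rule swap[OF n(2) M(1)])
  also have "\<dots> \<asymp> cycles M @ ?n u @ ?n z @ pos_part y"
    by (rule equiv_append[OF equiv_refl swap[OF n(2,3)]])
  also have "\<dots> \<asymp> cycles M @ ?n u @ ?n y @ pos_part z"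
    by (intro equiv_append[OF equiv_refl equiv_append[OF equiv_refl yz]])
  also have "\<dots> \<asymp> cycles M @ ?n y @ ?n u @ pos_part z"
    by (rule equiv_append[OF equiv_refl swap[OF n(3,1)]])
  finally show ?case
    using M(1) n(1) by (intro bexI[of _ "M @ neg_letters y"]) (simp_all add: cycles_append)
qed

text \<open>Positive words have an empty denominator. This is the converse of
  \<open>pos_word_equiv\<close> up to central powers.\<close>

lemma pos_word_hat_equiv_imp_stably_equiv:
  assumes "pos_word u \<asymp>\<^sub>y pos_word v" "u \<in> lists Os"
  shows "stably_equiv u v"
  using hat_equiv_pos_part[OF assms(1)] assms(2) by (simp add: stably_equiv_def)

text \<open>In the hat group, a word multiplied by its denominator equals its numerator. In the
  induction the central denominator of the tail moves past the leading letter.\<close>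

lemma pos_word_pos_part:
  "w \<in> hat_words \<Longrightarrow> pos_word (pos_part w) \<asymp>\<^sub>y pos_word (cycles (neg_letters w)) @ w"
proof (induction w)
  case (Cons x w)
  obtain g b where x: "x = (g, b)" by (cases x)
  let ?Z = "cycles (neg_letters w)" and ?r = "replicate (order G - 1) g"
  have w: "w \<in> hat_words" "g \<in> Os" using Cons.prems x by auto
  have IH: "pos_word (pos_part w) \<asymp>\<^sub>y pos_word ?Z @ w" using Cons.IH w by simp
  have "?Z @ [g] \<asymp> [g] @ ?Z" using w by (intro cycles_commute) simp_all
  from pos_word_equiv[OF this] have comm: "pos_word ?Z @ [(g, True)] \<asymp>\<^sub>y (g, True) # pos_word ?Z" by simp
  show ?case
  proof (cases b)
    case True
    have "(g, True) # pos_word (pos_part w) \<asymp>\<^sub>y ((g, True) # pos_word ?Z) @ w"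
      using hat_append[OF hat_refl IH, of "[(g, True)]"] by simp
    also have "\<dots> \<asymp>\<^sub>y (pos_word ?Z @ [(g, True)]) @ w"
      by (rule hat_append[OF hat_sym[OF comm] hat_refl])
    finally show ?thesis using True x by simp
  next
    case False
    have "pos_word ?r @ pos_word (pos_part w) \<asymp>\<^sub>y (pos_word ?r @ pos_word ?Z) @ w"
      using hat_append[OF hat_refl IH] by simp
    \<comment> \<open>The inserted \<open>y_g\<close> completes \<open>?r\<close> to a full cycle,
      and the inserted \<open>y_g^-1\<close> is the leading letter of the word.\<close>
    also have "\<dots> \<asymp>\<^sub>y (pos_word ?r @ pos_word ?Z) @ [(g, True), (g, \<not> True)] @ w"
      by (rule hat_sym) (rule hat_cancel[OF w(2)])
    also have "\<dots> = pos_word ?r @ (pos_word ?Z @ [(g, True)]) @ (g, False) # w" by simp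
    also have "\<dots> \<asymp>\<^sub>y pos_word ?r @ ((g, True) # pos_word ?Z) @ (g, False) # w"
      by (rule hat_context[OF comm])
    also have "\<dots> = pos_word (?r @ g # ?Z) @ (g, False) # w" by simp
    also have "\<dots> = pos_word (cycles (g # neg_letters w)) @ (g, False) # w"
      by (simp only: replicate_cycle cycles_Cons)
    finally show ?thesis using False x by simp
  qed
qed simp

text \<open>The exponent sum over the generators in \<open>C\<close>; these sums are the coordinates
  of the abelianization of the hat group.\<close>

definition signed_count :: "'a set \<Rightarrow> ('a \<times> bool) list \<Rightarrow> int" where
  "signed_count C w = (\<Sum>(g, b)\<leftarrow>w. if g \<in> C then (if b then 1 else -1) else 0)"

lemma signed_count_simps [simp]:
  "signed_count C [] = 0"
  "signed_count C ((g, b) # w) = (if g \<in> C then (if b then 1 else -1) else 0) + signed_count C w"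
  "signed_count C (u @ v) = signed_count C u + signed_count C v"
  by (simp_all add: signed_count_def)

lemma signed_count_pos_word [simp]: "signed_count C (pos_word w) = int (letters_in C w)"
  by (induction w) auto

lemma signed_count_inv_word [simp]: "signed_count C (inv_word w) = - signed_count C w"
  by (induction w) auto

text \<open>A negative letter of \<open>C\<close> contributes \<open>order G - 1\<close> on the
  left, and \<open>-1\<close> together with the \<open>order G\<close> letters of its cycle on the
  right.\<close>

lemma letters_in_pos_part:
  "int (letters_in C (pos_part w)) = signed_count C w + int (letters_in C (cycles (neg_letters w)))"
proof (induction w)
  case (Cons x w)
  obtain g b where "x = (g, b)" by (cases x)
  then show ?case using Cons.IH order_pos by (cases b) (auto simp: cycles_Cons)
qed simp

lemma signed_count_equiv:
  assumes "u \<asymp>\<^sub>y v" "u \<in> hat_words" and C: "C \<in> set Cs"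
  shows "signed_count C u = signed_count C v"
  using assms(1,2)
proof (rule hat_invariant)
  fix x y assume "hat_step G Os x y"
  then show "signed_count C x = signed_count C y"
    by cases (auto simp: class_conj_iff[OF C])
qed

text \<open>The negative letters are absorbed by splitting off full cycles from the positive part.\<close>

lemma positive_representative:
  assumes w: "w \<in> hat_words" and span: "spanning (pos_part w)"
    and large: "\<And>C. C \<in> set Cs \<Longrightarrow> int (order G * order G) \<le> signed_count C w"
  shows "\<exists>s. spanning s \<and> pos_word s \<asymp>\<^sub>y w"
proof -
  let ?Z = "cycles (neg_letters w)"
  have "order G * order G + letters_in C ?Z \<le> letters_in C (pos_part w)" if "C \<in> set Cs" for C
    using large[OF that] letters_in_pos_part[of C w] by linarith
  then obtain s where s: "pos_part w \<asymp> ?Z @ s" "spanning s"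
    using split_cycles[OF span neg_letters_lists[OF w]] by blast
  have Z: "pos_word ?Z \<in> hat_words" using w by simp
  have "pos_word ?Z @ pos_word s \<asymp>\<^sub>y pos_word (pos_part w)"
    using hat_sym[OF pos_word_equiv[OF s(1)]] by simp
  also have "\<dots> \<asymp>\<^sub>y pos_word ?Z @ w" by (rule pos_word_pos_part[OF w])
  finally have *: "pos_word ?Z @ pos_word s \<asymp>\<^sub>y pos_word ?Z @ w" .
  have cancel: "(inv_word (pos_word ?Z) @ pos_word ?Z) @ v \<asymp>\<^sub>y v" for v
    using hat_append[OF inv_word_left[OF Z] hat_refl, of v] by simp
  have "pos_word s \<asymp>\<^sub>y (inv_word (pos_word ?Z) @ pos_word ?Z) @ pos_word s"
    by (rule hat_sym[OF cancel])
  also have "\<dots> \<asymp>\<^sub>y (inv_word (pos_word ?Z) @ pos_word ?Z) @ w"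
    using hat_append[OF hat_refl *] by simp
  also have "\<dots> \<asymp>\<^sub>y w" by (rule cancel)
  finally show ?thesis using s(2) by blast
qed

section \<open>The derived subgroup of the hat group\<close>

definition conj_invariant_fun :: "('a \<Rightarrow> 'c) \<Rightarrow> bool" where
  "conj_invariant_fun f \<longleftrightarrow> (\<forall>g\<in>Os. \<forall>h\<in>Os. f (inv h \<otimes> g \<otimes> h) = f g)"

text \<open>Invariance under conjugation by elements of \<open>Os\<close> extends to the subgroup
  that they generate, which is all of \<open>G\<close>.\<close>

lemma conj_invariant_fun_class:
  assumes f: "conj_invariant_fun f" and C: "C \<in> set Cs" "a \<in> C" "b \<in> C"
  shows "f a = f b"
proof -
  have "f (inv k \<otimes> g \<otimes> k) = f g" if "k \<in> generate G Os" "g \<in> Os" for k g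
    using that
  proof (induction arbitrary: g)
    case (incl h)
    then show ?case using f by (simp add: conj_invariant_fun_def)
  next
    case (inv h)
    then have "f (inv h \<otimes> (h \<otimes> g \<otimes> inv h) \<otimes> h) = f (h \<otimes> g \<otimes> inv h)"
      using f unfolding conj_invariant_fun_def by (meson conj_closed' mem_carrier)
    with inv show ?case by (simp add: m_assoc)
  next
    case (eng h k)
    then have hk: "h \<in> carrier G" "k \<in> carrier G" by (simp_all add: generate_Os)
    have "f (inv (h \<otimes> k) \<otimes> g \<otimes> (h \<otimes> k)) = f (inv k \<otimes> (inv h \<otimes> g \<otimes> h) \<otimes> k)"
      using hk eng.prems by (simp add: inv_mult_group m_assoc)
    also have "\<dots> = f g" using eng hk by simp
    finally show ?case .
  qed simp
  moreover obtain k where "k \<in> carrier G" "b = inv k \<otimes> a \<otimes> k"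
    using class_eq[OF C(1,2)] C(3) by (auto simp: conj_class_def)
  moreover have "a \<in> Os" using C class_subset by blast
  ultimately show ?thesis using generate_Os by simp
qed

text \<open>Generators from one class have the same image in a commutative group, so the image of
  a word only depends on its signed counts.\<close>

lemma comm_hom_trivial:
  assumes Q: "comm_group Q" and \<phi>: "\<phi> \<in> hom hatG Q" and w: "w \<in> hat_words"
    and zero: "\<And>C. C \<in> set Cs \<Longrightarrow> signed_count C w = 0"
  shows "\<phi> (hat_class G Os w) = \<one>\<^bsub>Q\<^esub>"
proof -
  interpret Q: comm_group Q by (rule Q)
  interpret H: group hatG by (rule group_hatG)
  interpret \<phi>: group_hom hatG Q \<phi> using \<phi> by unfold_locales
  let ?c = "hat_class G Os"
  define f where "f g = \<phi> (?c [(g, True)])" for g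
  have f_closed: "f g \<in> carrier Q" if "g \<in> Os" for g
    using that by (simp add: f_def)
  have inv_letter: "\<phi> (?c [(g, False)]) = inv\<^bsub>Q\<^esub> (f g)" if "g \<in> Os" for g
    using that inv_hatG[of "[(g, True)]"] \<phi>.hom_inv[of "?c [(g, True)]"] by (simp add: f_def)
  have "conj_invariant_fun f"
    unfolding conj_invariant_fun_def
  proof (intro ballI)
    fix g h assume gh: "g \<in> Os" "h \<in> Os"
    have "?c [(h, False), (g, True), (h, True)] = ?c [(inv h \<otimes> g \<otimes> h, True)]"
      using hat_relator[OF gh, of "[]" "[]"] gh by (intro hat_class_eq_iff[THEN iffD2]) auto
    then have "f (inv h \<otimes> g \<otimes> h) = \<phi> (?c [(h, False)] \<otimes>\<^bsub>hatG\<^esub> (?c [(g, True)] \<otimes>\<^bsub>hatG\<^esub> ?c [(h, True)]))"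
      using gh by (simp add: f_def mult_hatG)
    also have "\<dots> = inv\<^bsub>Q\<^esub> (f h) \<otimes>\<^bsub>Q\<^esub> (f g \<otimes>\<^bsub>Q\<^esub> f h)"
      using inv_letter[OF gh(2)] gh by (simp add: f_def)
    also have "\<dots> = f g"
      using f_closed gh by (simp add: Q.m_comm[of "f g" "f h"])
    finally show "f (inv h \<otimes> g \<otimes> h) = f g" .
  qed
  note const = conj_invariant_fun_class[OF this]
  \<comment> \<open>\<open>f\<close> is constant on each class, and \<open>r C\<close> is its value
    there.\<close>
  define r where "r C = f (SOME g. g \<in> C)" for C
  have r: "r C = f g" if "C \<in> set Cs" "g \<in> C" for C g
    unfolding r_def using that by (intro const[OF that(1)] someI[of "\<lambda>g. g \<in> C"])
  have r_closed: "r C \<in> carrier Q" if C: "C \<in> set Cs" for C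
  proof -
    have "\<exists>g. g \<in> C"
      using C equipped by (force simp: equipped_def conj_class_def)
    then show ?thesis using r[OF C] f_closed class_subset[OF C] by auto
  qed
  have "\<phi> (?c w) = (\<Otimes>\<^bsub>Q\<^esub>C\<in>set Cs. r C [^]\<^bsub>Q\<^esub> signed_count C w)"
    using w
  proof (induction w rule: list.induct)
    case Nil
    then show ?case by (simp flip: one_hatG)
  next
    case (Cons x w)
    obtain g b where x: "x = (g, b)" by (cases x)
    have g: "g \<in> Os" and w: "w \<in> hat_words" using Cons.prems x by auto
    let ?e = "if b then 1 else -1 :: int"
    obtain D where D: "D \<in> set Cs" "g \<in> D" using g Os_eq by blast
    have mem: "g \<in> C \<longleftrightarrow> D = C" if "C \<in> set Cs" for C
      using class_unique[OF D(1) that D(2)] D(2) by blast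
    have "\<phi> (?c [(g, b)]) = r D [^]\<^bsub>Q\<^esub> ?e"
      using r[OF D] inv_letter[OF g] f_closed[OF g] by (cases b) (simp_all add: f_def Q.int_pow_neg)
    \<comment> \<open>The image of one letter is written as a product over all classes with a single
      nontrivial factor, so that it can be multiplied factor by factor with the product for the
      tail.\<close>
    also have "\<dots> = (\<Otimes>\<^bsub>Q\<^esub>C\<in>set Cs. if D = C then r C [^]\<^bsub>Q\<^esub> ?e else \<one>\<^bsub>Q\<^esub>)"
      using D r_closed by (intro Q.finprod_singleton[symmetric]) auto
    finally have letter: "\<phi> (?c [(g, b)]) =
      (\<Otimes>\<^bsub>Q\<^esub>C\<in>set Cs. if D = C then r C [^]\<^bsub>Q\<^esub> ?e else \<one>\<^bsub>Q\<^esub>)" .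
    have "?c (x # w) = ?c [(g, b)] \<otimes>\<^bsub>hatG\<^esub> ?c w"
      using g w x by (simp add: mult_hatG)
    then have "\<phi> (?c (x # w)) = \<phi> (?c [(g, b)]) \<otimes>\<^bsub>Q\<^esub> \<phi> (?c w)"
      using g w by simp
    also have "\<dots> = (\<Otimes>\<^bsub>Q\<^esub>C\<in>set Cs. (if D = C then r C [^]\<^bsub>Q\<^esub> ?e else \<one>\<^bsub>Q\<^esub>) \<otimes>\<^bsub>Q\<^esub> r C [^]\<^bsub>Q\<^esub> signed_count C w)"
      unfolding letter Cons.IH[OF w] using r_closed by (intro Q.finprod_multf[symmetric]) auto
    also have "\<dots> = (\<Otimes>\<^bsub>Q\<^esub>C\<in>set Cs. r C [^]\<^bsub>Q\<^esub> signed_count C (x # w))"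
    proof (rule Q.finprod_cong'[OF refl])
      show "(\<lambda>C. r C [^]\<^bsub>Q\<^esub> signed_count C (x # w)) \<in> set Cs \<rightarrow> carrier Q"
        using r_closed by auto
    next
      fix C assume "C \<in> set Cs"
      then show "(if D = C then r C [^]\<^bsub>Q\<^esub> ?e else \<one>\<^bsub>Q\<^esub>) \<otimes>\<^bsub>Q\<^esub> r C [^]\<^bsub>Q\<^esub> signed_count C w
          = r C [^]\<^bsub>Q\<^esub> signed_count C (x # w)"
        using mem r_closed by (simp add: x Q.int_pow_mult)
    qed
    finally show ?case .
  qed
  also have "\<dots> = \<one>\<^bsub>Q\<^esub>"
    by (rule Q.finprod_one_eqI) (simp add: zero)
  finally show ?thesis .
qed

text \<open>Signed counts are homomorphisms to the integers and so vanish on the derived subgroup.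
  Conversely, \<open>comm_hom_trivial\<close> applies to the projection onto the quotient by the
  derived subgroup, which is commutative.\<close>

lemma hat_class_derived_iff:
  assumes w: "w \<in> hat_words"
  shows "hat_class G Os w \<in> derived hatG (carrier hatG) \<longleftrightarrow> (\<forall>C\<in>set Cs. signed_count C w = 0)"
proof
  interpret H: group hatG by (rule group_hatG)
  assume der: "hat_class G Os w \<in> derived hatG (carrier hatG)"
  show "\<forall>C\<in>set Cs. signed_count C w = 0"
  proof
    fix C assume C: "C \<in> set Cs"
    define \<chi> where "\<chi> A = signed_count C (SOME a. a \<in> A)" for A
    have \<chi>: "\<chi> (hat_class G Os u) = signed_count C u" if "u \<in> hat_words" for u
      unfolding \<chi>_def using hat_class_some[OF that] signed_count_equiv[OF _ that C] by metis
    interpret Z: comm_group integer_group by (rule abelian_integer_group)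
    have "\<chi> \<in> hom hatG integer_group"
    proof (rule homI)
      fix A B assume "A \<in> carrier hatG" "B \<in> carrier hatG"
      then obtain u v where "u \<in> hat_words" "v \<in> hat_words"
        "A = hat_class G Os u" "B = hat_class G Os v"
        unfolding carrier_hatG by (elim imageE)
      then show "\<chi> (A \<otimes>\<^bsub>hatG\<^esub> B) = \<chi> A \<otimes>\<^bsub>integer_group\<^esub> \<chi> B"
        by (simp add: mult_hatG \<chi>)
    qed simp
    then interpret \<chi>: group_hom hatG integer_group \<chi> by unfold_locales
    have "\<chi> ` derived hatG (carrier hatG) = derived integer_group (\<chi> ` carrier hatG)"
      by (rule \<chi>.derived_img[symmetric]) simp
    also have "\<dots> = {0}" using Z.derived_eq_singleton[of "\<chi> ` carrier hatG"] by simp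
    finally show "signed_count C w = 0" using imageI[OF der, of \<chi>] \<chi>[OF w] by simp
  qed
next
  interpret H: group hatG by (rule group_hatG)
  let ?D = "derived hatG (carrier hatG)"
  assume zero: "\<forall>C\<in>set Cs. signed_count C w = 0"
  interpret D: normal ?D hatG
    by (rule H.derived_self_is_normal)
  have "?D #>\<^bsub>hatG\<^esub> hat_class G Os w = \<one>\<^bsub>hatG Mod ?D\<^esub>"
    using zero by (intro comm_hom_trivial[OF H.derived_quot_is_comm_group D.r_coset_hom_Mod w]) auto
  then show "hat_class G Os w \<in> ?D"
    using H.coset_join1[of ?D "hat_class G Os w"] w D.is_subgroup by (simp add: FactGroup_def)
qed

section \<open>Counting elements of given type and product\<close>

lemma fact_class_eq_iff: "fact_class G Os u = fact_class G Os v \<longleftrightarrow> u \<asymp> v"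
proof
  assume "fact_class G Os u = fact_class G Os v"
  moreover have "v \<in> fact_class G Os v" by (simp add: fact_class_def)
  ultimately show "u \<asymp> v" by (auto simp: fact_class_def)
next
  assume uv: "u \<asymp> v"
  have "u \<asymp> x \<longleftrightarrow> v \<asymp> x" for x
    using equiv_trans[OF uv] equiv_trans[OF equiv_sym[OF uv]] by blast
  then show "fact_class G Os u = fact_class G Os v" by (simp add: fact_class_def)
qed

lemma rep_fact_class: "w \<asymp> rep (fact_class G Os w)"
proof -
  have "w \<in> fact_class G Os w" by (simp add: fact_class_def)
  then have "rep (fact_class G Os w) \<in> fact_class G Os w" unfolding rep_def by (rule someI)
  then show ?thesis by (simp add: fact_class_def)
qed

lemma fact_class_mem_gen_iff:
  assumes "w \<in> lists Os" "w \<noteq> []"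
  shows "fact_class G Os w \<in> fact_semigroup_gen G Os \<longleftrightarrow> spanning w"
proof -
  have "fact_class G Os w \<in> fact_semigroup G Os" using assms by (auto simp: fact_semigroup_def)
  then show ?thesis
    using equiv_generate[OF rep_fact_class assms(1)] assms(1)
    by (simp add: fact_semigroup_gen_def sub_gen_def spanning_def)
qed

lemma fact_semigroup_gen_cases:
  assumes "s \<in> fact_semigroup_gen G Os"
  obtains w where "spanning w" "w \<noteq> []" "s = fact_class G Os w"
proof -
  from assms obtain w where w: "w \<in> lists Os" "w \<noteq> []" "s = fact_class G Os w"
    by (auto simp: fact_semigroup_gen_def fact_semigroup_def)
  with assms fact_class_mem_gen_iff[OF w(1,2)] show ?thesis by (intro that) auto
qed

lemma alpha_fact_class: "w \<in> lists Os \<Longrightarrow> alpha G (fact_class G Os w) = word_prod G w"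
  unfolding alpha_def using equiv_word_prod[OF rep_fact_class] by metis

lemma tau_i_fact_class: "i < length Cs \<Longrightarrow> tau_i Cs i (fact_class G Os w) = letters_in (Cs ! i) w"
  unfolding tau_i_def using equiv_letters_in[OF rep_fact_class nth_mem] by metis

lemma tau_fact_class_eq_iff:
  "tau Cs (fact_class G Os u) = tau Cs (fact_class G Os v) \<longleftrightarrow>
     (\<forall>C\<in>set Cs. letters_in C u = letters_in C v)"
proof -
  have "tau Cs (fact_class G Os w) = map (\<lambda>C. letters_in C w) Cs" for w
    by (rule nth_equalityI) (simp_all add: tau_def tau_i_fact_class)
  then show ?thesis by simp
qed

text \<open>Every letter lies in some class. The bound makes the fibres finite and forces a word
  with the letter counts of a nonempty word to be nonempty.\<close>

lemma length_le_sum_letters_in: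
  "w \<in> lists Os \<Longrightarrow> length w \<le> (\<Sum>C\<in>set Cs. letters_in C w)"
proof (induction w)
  case (Cons a w)
  then obtain C where C: "C \<in> set Cs" "a \<in> C" using Os_eq by auto
  have "1 \<le> (\<Sum>D\<in>set Cs. if a \<in> D then 1 else 0 :: nat)"
    using member_le_sum[of C "set Cs" "\<lambda>D. if a \<in> D then 1 else 0 :: nat"] C by simp
  also have "length w + \<dots> \<le> (\<Sum>D\<in>set Cs. letters_in D w + (if a \<in> D then 1 else 0))"
    using Cons by (simp add: sum.distrib)
  also have "\<dots> = (\<Sum>D\<in>set Cs. letters_in D (a # w))"
    by (rule sum.cong) auto
  finally show ?case by simp
qed simp

section \<open>Fibres over a given type and product\<close>

definition fibre :: "'a list set \<Rightarrow> 'a list set set" where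
  "fibre s1 = {s \<in> fact_semigroup_gen G Os. tau Cs s = tau Cs s1 \<and> alpha G s = alpha G s1}"

lemma finite_fibre: "finite (fibre (fact_class G Os w))"
proof -
  let ?n = "\<Sum>C\<in>set Cs. letters_in C w"
  have "fibre (fact_class G Os w) \<subseteq> fact_class G Os ` {u. set u \<subseteq> Os \<and> length u \<le> ?n}"
  proof
    fix s assume s: "s \<in> fibre (fact_class G Os w)"
    then obtain u where u: "spanning u" "s = fact_class G Os u"
      by (auto simp: fibre_def elim: fact_semigroup_gen_cases)
    then have "\<forall>C\<in>set Cs. letters_in C u = letters_in C w"
      using s tau_fact_class_eq_iff[of u w] by (simp add: fibre_def)
    then have "length u \<le> ?n"
      using length_le_sum_letters_in[of u] u(1) by simp
    with u show "s \<in> fact_class G Os ` {u. set u \<subseteq> Os \<and> length u \<le> ?n}"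
      by (auto simp: spanning_def)
  qed
  then show ?thesis
    by (rule finite_subset) (intro finite_imageI finite_lists_length_le finite_Os)
qed

text \<open>Right multiplication by the inverse of \<open>w\<close> in the hat group maps the fibre
  bijectively onto the intersection of kernel and derived subgroup. Equal products put the image
  into the kernel, and equal types put it into the derived subgroup. Surjectivity holds since
  \<open>v\<close> times \<open>w\<close> has a positive representative for every \<open>v\<close>
  in the intersection.\<close>

lemma card_fibre:
  "\<exists>T. \<forall>w. spanning w \<longrightarrow> w \<noteq> [] \<longrightarrow> (\<forall>C\<in>set Cs. T \<le> letters_in C w) \<longrightarrow>
     card (fibre (fact_class G Os w)) = ambiguity_index G Os"
proof -
  obtain T where T: "\<forall>u v. spanning u \<longrightarrow> spanning v \<longrightarrow> stably_equiv u v \<longrightarrow>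
     (\<forall>C\<in>set Cs. T \<le> letters_in C u) \<longrightarrow> u \<asymp> v"
    using stably_equiv_imp_equiv by blast
  show ?thesis
  proof (intro exI allI impI)
    fix w
    \<comment> \<open>In the bound, the summand \<open>T\<close> serves injectivity, through the
      passage from stable equivalence to equivalence; \<open>order G * order G\<close> is the
      reserve for \<open>positive_representative\<close>.\<close>
    assume w: "spanning w" "w \<noteq> []"
      and large: "\<forall>C\<in>set Cs. T + order G * order G \<le> letters_in C w"
    let ?c = "fact_class G Os" and ?h = "hat_class G Os" and ?I = "inv_word (pos_word w)"
    let ?K = "kernel hatG G (hat_beta G) \<inter> derived hatG (carrier hatG)"
    define \<psi> where "\<psi> s = ?h (pos_word (rep s) @ ?I)" for s
    have hw [simp]: "pos_word w \<in> hat_words" "?I \<in> hat_words" using w by simp_all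
    have I_right: "pos_word w @ ?I \<asymp>\<^sub>y []" by (rule inv_word_right) simp
    have I_left: "?I @ pos_word w \<asymp>\<^sub>y []" by (rule inv_word_left) simp
    have value_I: "word_prod G w \<otimes> word_value ?I = \<one>"
      using word_value_equiv[OF I_right] by (simp add: word_value_append word_value_pos_word)
        (simp add: word_value_def)
    have \<psi>: "\<psi> (?c u) = ?h (pos_word u @ ?I)" if "u \<in> lists Os" for u
    proof -
      have *: "pos_word u @ ?I \<asymp>\<^sub>y pos_word (rep (?c u)) @ ?I"
        by (intro hat_append pos_word_equiv rep_fact_class hat_refl)
      have "rep (?c u) \<in> lists Os" using equiv_lists[OF rep_fact_class] that by blast
      then show ?thesis
        unfolding \<psi>_def using hat_class_eq_iff[THEN iffD2, OF _ _ *] that by simp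
    qed
    have fibreE: thesis
      if "s \<in> fibre (?c w)"
        "\<And>u. \<lbrakk>spanning u; s = ?c u; \<forall>C\<in>set Cs. letters_in C u = letters_in C w;
           word_prod G u = word_prod G w\<rbrakk> \<Longrightarrow> thesis" for s thesis
    proof -
      from that(1) obtain u where u: "spanning u" "s = ?c u"
        by (auto simp: fibre_def elim: fact_semigroup_gen_cases)
      with that(1) have "\<forall>C\<in>set Cs. letters_in C u = letters_in C w" "word_prod G u = word_prod G w"
        using tau_fact_class_eq_iff[of u w] alpha_fact_class[of u] alpha_fact_class[of w] w
        by (simp_all add: fibre_def)
      with u show thesis by (rule that(2))
    qed
    have "bij_betw \<psi> (fibre (?c w)) ?K"
    proof (rule bij_betw_imageI)
      show "inj_on \<psi> (fibre (?c w))"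
      proof (rule inj_onI)
        fix s t assume s: "s \<in> fibre (?c w)" and t: "t \<in> fibre (?c w)" and eq: "\<psi> s = \<psi> t"
        from s obtain u where u: "spanning u" "s = ?c u"
          "\<forall>C\<in>set Cs. letters_in C u = letters_in C w" by (rule fibreE)
        from t obtain v where v: "spanning v" "t = ?c v" by (rule fibreE)
        have "pos_word u @ ?I \<asymp>\<^sub>y pos_word v @ ?I"
          using eq u v hat_class_eq_iff[of "pos_word u @ ?I" "pos_word v @ ?I"] by (simp add: \<psi>)
        from hat_append[OF this hat_refl, of "pos_word w"]
        have *: "pos_word u @ ?I @ pos_word w \<asymp>\<^sub>y pos_word v @ ?I @ pos_word w" by simp
        have cancel: "pos_word x @ ?I @ pos_word w \<asymp>\<^sub>y pos_word x" for x
          using hat_append[OF hat_refl I_left, of "pos_word x"] by simp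
        have "pos_word u \<asymp>\<^sub>y pos_word v"
          by (rule hat_trans[OF hat_sym[OF cancel] hat_trans[OF * cancel]])
        then have "stably_equiv u v" using u by (intro pos_word_hat_equiv_imp_stably_equiv) simp_all
        moreover have "\<forall>C\<in>set Cs. T \<le> letters_in C u" using u(3) large by force
        ultimately have "u \<asymp> v" using T u(1) v(1) by blast
        then show "s = t" using u v by (simp add: fact_class_eq_iff)
      qed
      show "\<psi> ` fibre (?c w) = ?K"
      proof (intro equalityI subsetI)
        fix x assume "x \<in> \<psi> ` fibre (?c w)"
        then obtain s where s: "s \<in> fibre (?c w)" "x = \<psi> s" by blast
        from s(1) obtain u where u: "spanning u" "s = ?c u"
          "\<forall>C\<in>set Cs. letters_in C u = letters_in C w" "word_prod G u = word_prod G w" by (rule fibreE)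
        have x: "x = ?h (pos_word u @ ?I)" using s u \<psi> by simp
        have "word_value (pos_word u @ ?I) = \<one>"
          using u value_I by (simp add: word_value_append word_value_pos_word)
        then have "x \<in> kernel hatG G (hat_beta G)"
          using u x by (simp add: kernel_def hat_beta_hat_class)
        moreover have "x \<in> derived hatG (carrier hatG)"
          using u x by (simp add: hat_class_derived_iff)
        ultimately show "x \<in> ?K" by blast
      next
        fix x assume x: "x \<in> ?K"
        then obtain v where v: "v \<in> hat_words" "x = ?h v"
          unfolding kernel_def carrier_hatG by blast
        have val: "word_value v = \<one>" and zero: "\<forall>C\<in>set Cs. signed_count C v = 0"
          using x v by (simp_all add: kernel_def hat_beta_hat_class hat_class_derived_iff)
        have vw: "v @ pos_word w \<in> hat_words" using v hw by simp
        have "\<exists>u. spanning u \<and> pos_word u \<asymp>\<^sub>y v @ pos_word w"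
        proof (rule positive_representative[OF vw])
          show "spanning (pos_part (v @ pos_word w))"
            using spanning_append[OF w(1), of "pos_part v"] v by simp
          show "int (order G * order G) \<le> signed_count C (v @ pos_word w)" if "C \<in> set Cs" for C
          proof -
            have "order G * order G \<le> letters_in C w" using bspec[OF large that] by linarith
            then show ?thesis using zero that by (simp only: signed_count_simps signed_count_pos_word)
          qed
        qed
        then obtain u where u: "spanning u" "pos_word u \<asymp>\<^sub>y v @ pos_word w" by blast
        have pu: "pos_word u \<in> hat_words" using u by simp
        have counts: "\<forall>C\<in>set Cs. letters_in C u = letters_in C w"
          using signed_count_equiv[OF u(2) pu] zero by simp
        have prods: "word_prod G u = word_prod G w"
          using word_value_equiv[OF u(2) pu] v val w lists_carrier[of w]
          by (simp add: word_value_append word_value_pos_word)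
        \<comment> \<open>The factorization semigroup contains no class of the empty word, so this
          is needed for \<open>u\<close> to represent an element of it.\<close>
        have "u \<noteq> []"
        proof
          assume "u = []"
          then have "(\<Sum>C\<in>set Cs. letters_in C w) = 0" using counts by simp
          then show False using length_le_sum_letters_in[of w] w by simp
        qed
        then have "?c u \<in> fact_semigroup_gen G Os"
          using u fact_class_mem_gen_iff[of u] by simp
        then have mem: "?c u \<in> fibre (?c w)"
          using counts prods u w by (simp add: fibre_def tau_fact_class_eq_iff alpha_fact_class)
        have "pos_word u @ ?I \<asymp>\<^sub>y (v @ pos_word w) @ ?I"
          by (rule hat_append[OF u(2) hat_refl])
        also have "\<dots> \<asymp>\<^sub>y v"
          using hat_append[OF hat_refl I_right, of v] by simp
        finally have "\<psi> (?c u) = x"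
          using hat_class_eq_iff[of "pos_word u @ ?I" v] u v by (simp add: \<psi>)
        with mem show "x \<in> \<psi> ` fibre (?c w)" by blast
      qed
    qed
    then show "card (fibre (?c w)) = ambiguity_index G Os"
      unfolding ambiguity_index_def by (rule bij_betw_same_card)
  qed
qed

end

theorem theorem4p2:
  fixes G :: "('a, 'b) monoid_scheme" and Cs :: "'a set list"
  defines "Os \<equiv> \<Union>(set Cs)"
  assumes "equipped G Cs"
    and "finite (carrier G)"
    and "generate G Os = carrier G"
  shows "\<exists>T::nat. \<forall>s1 \<in> fact_semigroup_gen G Os.
           (\<forall>i < length Cs. tau_i Cs i s1 \<ge> T) \<longrightarrow>
           (\<exists>ss. length ss = ambiguity_index G Os \<and> distinct ss \<and> ss ! 0 = s1 \<and>
                 set ss \<subseteq> fact_semigroup_gen G Os \<and>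
                 (\<forall>s \<in> set ss. tau Cs s = tau Cs s1 \<and> alpha G s = alpha G s1) \<and>
                 (\<forall>s \<in> fact_semigroup_gen G Os.
                     tau Cs s = tau Cs s1 \<and> alpha G s = alpha G s1 \<longrightarrow> s \<in> set ss))"
proof -
  interpret group G using assms(2) by (simp add: equipped_def)
  have conj: "inv\<^bsub>G\<^esub> g \<otimes>\<^bsub>G\<^esub> a \<otimes>\<^bsub>G\<^esub> g \<in> Os" if "a \<in> Os" "g \<in> carrier G" for a g
  proof -
    obtain C where C: "C \<in> set Cs" "a \<in> C" using \<open>a \<in> Os\<close> Os_def by blast
    then obtain x where "x \<in> carrier G" "C = conj_class G x"
      using assms(2) by (auto simp: equipped_def)
    then have "C = conj_class G a" using C conj_class_eq_if_mem by blast
    then have "inv\<^bsub>G\<^esub> g \<otimes>\<^bsub>G\<^esub> a \<otimes>\<^bsub>G\<^esub> g \<in> C" using that by (auto simp: conj_class_def)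
    then show ?thesis using C Os_def by blast
  qed
  have sub: "Os \<subseteq> carrier G"
    using assms(2) unfolding Os_def equipped_def by (fastforce simp: conj_class_def)
  interpret finite_equipped_group G Os Cs
    using assms conj sub by unfold_locales simp_all
  obtain T where T: "\<And>w. \<lbrakk>spanning w; w \<noteq> []; \<forall>C\<in>set Cs. T \<le> letters_in C w\<rbrakk> \<Longrightarrow>
     card (fibre (fact_class G Os w)) = ambiguity_index G Os"
    using card_fibre by blast
  show ?thesis
  proof (rule exI[of _ T], intro ballI impI)
    fix s1
    assume s1: "s1 \<in> fact_semigroup_gen G Os" and large: "\<forall>i < length Cs. tau_i Cs i s1 \<ge> T"
    from s1 obtain w where w: "spanning w" "w \<noteq> []" "s1 = fact_class G Os w"
      by (rule fact_semigroup_gen_cases)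
    have "\<forall>C\<in>set Cs. T \<le> letters_in C w"
      using large w(3) by (auto simp: in_set_conv_nth tau_i_fact_class)
    with w have card: "card (fibre s1) = ambiguity_index G Os" by (simp add: T)
    have fin: "finite (fibre s1)" using finite_fibre w(3) by simp
    \<comment> \<open>\<open>s1\<close> is removed from the enumeration of the fibre so that it can
      be placed at position 0 of the list.\<close>
    then obtain rest where rest: "set rest = fibre s1 - {s1}" "distinct rest"
      using finite_distinct_list[of "fibre s1 - {s1}"] by auto
    have mem: "s1 \<in> fibre s1" using s1 by (simp add: fibre_def)
    then have set: "set (s1 # rest) = fibre s1" using rest by auto
    have dist: "distinct (s1 # rest)" using rest by simp
    then have "length (s1 # rest) = ambiguity_index G Os"
      using distinct_card[OF dist] by (simp only: set card)
    with set dist show "\<exists>ss. length ss = ambiguity_index G Os \<and> distinct ss \<and> ss ! 0 = s1 \<and>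
                 set ss \<subseteq> fact_semigroup_gen G Os \<and>
                 (\<forall>s \<in> set ss. tau Cs s = tau Cs s1 \<and> alpha G s = alpha G s1) \<and>
                 (\<forall>s \<in> fact_semigroup_gen G Os.
                     tau Cs s = tau Cs s1 \<and> alpha G s = alpha G s1 \<longrightarrow> s \<in> set ss)"
      by (intro exI[of _ "s1 # rest"]) (auto simp: fibre_def)
  qed
qed

end
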